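(* Let $d\geq 2$, let $A,B\subset \mathbb{R}^d$ be finite non-empty sets and let $l$ be a line in $\mathbb{R}^d$. Let $r$ be the number of lines parallel to $l$ which intersect $A$. Suppose that $\dim(A) = d$, $|A|\geq |B|$ and $$|A+B|<|A|+\left(d+\frac13\right)|B|-2^{d+1}\sqrt{|A|}-E_d,$$ where $E_d=(d+2)^{2^d-2}$. Then $r=d$ or $r>|A|/4$.
   Context: $A + B = \{a + b : a \in A, b \in B\}$. For $A \subset \mathbb{R}^d$, $\dim(A)$ denotes the dimension of the affine subspace spanned by $A$. A line is considered parallel to itself. *)

theory Defs
  imports "HOL-Analysis.Analysis" "HOL-Library.Set_Algebras"
begin

definition is_line :: "'a::euclidean_space set \<Rightarrow> bool" where
  "is_line l \<longleftrightarrow> affine l \<and> aff_dim l = 1"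

text \<open>
  Two lines are parallel iff they are translates of each other, so every line
  is parallel to itself.  The family counted below is in bijection with a partition of
  the set \<open>A\<close> when \<open>l\<close> is a line; in particular it is finite whenever \<open>A\<close> is.
\<close>

definition lines_meeting :: "'a::euclidean_space set \<Rightarrow> 'a set \<Rightarrow> 'a set set" where
  "lines_meeting l A = {m. is_line m \<and> affine_parallel l m \<and> m \<inter> A \<noteq> {}}"

definition E_const :: "nat \<Rightarrow> nat" where
  "E_const d = (d + 2) ^ (2 ^ d - 2)"

end

theory Submission
  imports Defs
begin

text \<open>
  All reductions are compressions: on each line of a fixed direction the points of \<open>A\<close> are pushed
  to an initial segment. This keeps \<open>|A|\<close> and \<open>|B|\<close>, does not increase \<open>|A + B|\<close>, and does not
  increase the number of lines parallel to \<open>l\<close> meeting \<open>A\<close>. After a linear change of coordinates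
  taking \<open>l\<close> to the direction \<open>e\<^sub>z\<close>, compressing along the axes gives \<open>0, e\<^sub>j \<in> A\<close> for \<open>j \<noteq> z\<close>, and since
  \<open>A\<close> meets more than \<open>d\<close> lines one also gets \<open>2e\<^sub>a \<in> A\<close> for some \<open>a \<noteq> z\<close>.

  Let \<open>J\<close> consist of the \<open>d - 2\<close> other directions and let \<open>P\<close> be the part of \<open>A\<close> in the plane spanned
  by \<open>e\<^sub>a\<close> and \<open>e\<^sub>z\<close>. Compressing in the directions \<open>e\<^sub>j - v\<close> with \<open>j \<in> J\<close>, \<open>v \<in> P\<close>, until the sum of the
  \<open>J\<close>-coordinates is minimal, forces \<open>A = P \<union> {e\<^sub>j : j \<in> J}\<close>, and forces \<open>B\<close> to have at most \<open>d - 2\<close>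
  points outside its planar part \<open>Q\<close>; hence \<open>|A + B| \<ge> |P + Q| + (d - 2) |Q|\<close>.
  The planar sumset is bounded by the Grynkiewicz--Serra inequality
  \<open>|P + Q| \<ge> (\<alpha> + \<beta> - 1) (|P| / \<alpha> + |Q| / \<beta> - 1)\<close>, where \<open>\<alpha>\<close> and \<open>\<beta>\<close> count the columns of \<open>P\<close> and
  \<open>Q\<close>; as \<open>3 \<le> \<alpha> \<le> |P| / 4\<close>, this is at least \<open>|P| + 7/3 |Q| - 16\<close> when \<open>|Q| \<le> |P|\<close>.
\<close>

subsection \<open>Planar sumsets and columns\<close>

text \<open>The translates \<open>Min X + Y\<close> and \<open>X + Max Y\<close> both lie in
  \<open>X + Y\<close> and can share only the point \<open>Min X + Max Y\<close>.\<close>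

lemma card_sumset_ge_real:
  fixes X Y :: "real set"
  assumes "finite X" "finite Y" "X \<noteq> {}" "Y \<noteq> {}"
  shows "card X + card Y \<le> card (X + Y) + 1"
proof -
  let ?P = "(+) (Min X) ` Y" and ?Q = "(\<lambda>x. x + Max Y) ` X"
  have "?P \<inter> ?Q \<subseteq> {Min X + Max Y}"
  proof
    fix t assume "t \<in> ?P \<inter> ?Q"
    then obtain y x where "y \<in> Y" "x \<in> X" "t = Min X + y" "t = x + Max Y" by auto
    moreover from this have "y \<le> Max Y" "Min X \<le> x" using assms by auto
    ultimately show "t \<in> {Min X + Max Y}" by auto
  qed
  then have "card (?P \<inter> ?Q) \<le> 1"
    using card_mono[of "{Min X + Max Y}" "?P \<inter> ?Q"] by simp
  moreover have "card ?P = card Y" "card ?Q = card X"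
    by (auto intro!: card_image inj_onI)
  moreover have "card (?P \<union> ?Q) + card (?P \<inter> ?Q) = card ?P + card ?Q"
    using card_Un_Int[of ?P ?Q] assms by simp
  moreover have "card (?P \<union> ?Q) \<le> card (X + Y)"
    using assms by (intro card_mono finite_set_plus) (auto intro!: set_plus_intro Min_in Max_in)
  ultimately show ?thesis by linarith
qed

lemma card_sumset_ge_of_inj:
  fixes f :: "'a::ab_group_add \<Rightarrow> real"
  assumes "finite X" "finite Y" "X \<noteq> {}" "Y \<noteq> {}"
    and add: "\<And>x y. f (x + y) = f x + f y" and "inj_on f X" "inj_on f Y"
  shows "card X + card Y \<le> card (X + Y) + 1"
proof -
  have "f ` (X + Y) = f ` X + f ` Y"
    using add by (auto simp: set_plus_def image_iff) metis+
  then have "card (f ` X + f ` Y) \<le> card (X + Y)"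
    using card_image_le[of "X + Y" f] assms by (simp add: finite_set_plus)
  with card_sumset_ge_real[of "f ` X" "f ` Y"] assms show ?thesis
    by (simp add: card_image)
qed

text \<open>The last columns add up inside the last column of \<open>A + B\<close>, which
  \<open>(A - A1) + B\<close> never reaches; there the one-dimensional bound applies. The set
  \<open>A - A1\<close> may be empty, so a single column is covered as well.\<close>

lemma card_sumset_top_column:
  fixes A B :: "(real \<times> real) set"
  assumes "finite A" "finite B" "A \<noteq> {}" "B \<noteq> {}"
  defines "A1 \<equiv> {x \<in> A. fst x = Max (fst ` A)}" and "B1 \<equiv> {x \<in> B. fst x = Max (fst ` B)}"
  shows "card ((A - A1) + B) + card A1 + card B1 \<le> card (A + B) + 1"
proof -
  have "Max (fst ` A) \<in> fst ` A" "Max (fst ` B) \<in> fst ` B" using assms by auto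
  then have ne: "A1 \<noteq> {}" "B1 \<noteq> {}" unfolding A1_def B1_def by auto
  have fin: "finite A1" "finite B1" using assms by auto
  have "inj_on snd A1" "inj_on snd B1" by (auto simp: A1_def B1_def inj_on_def prod_eq_iff)
  then have 1: "card A1 + card B1 \<le> card (A1 + B1) + 1"
    using ne fin by (intro card_sumset_ge_of_inj[where f = snd]) auto
  have "fst t < Max (fst ` A) + Max (fst ` B)" if t: "t \<in> (A - A1) + B" for t
  proof -
    obtain x y where xy: "x \<in> A" "x \<notin> A1" "y \<in> B" "t = x + y" using t unfolding set_plus_def by blast
    then have "fst x \<le> Max (fst ` A)" "fst y \<le> Max (fst ` B)" "fst x \<noteq> Max (fst ` A)"
      using assms by auto
    then show ?thesis using xy by simp
  qed
  moreover have "fst t = Max (fst ` A) + Max (fst ` B)" if "t \<in> A1 + B1" for t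
    using that by (auto simp: A1_def B1_def elim!: set_plus_elim)
  ultimately have "((A - A1) + B) \<inter> (A1 + B1) = {}" by fastforce
  then have "card ((A - A1) + B) + card (A1 + B1) = card (((A - A1) + B) \<union> (A1 + B1))"
    using assms fin by (simp add: card_Un_disjoint finite_set_plus)
  also have "\<dots> \<le> card (A + B)"
    using assms(1,2) by (intro card_mono finite_set_plus Un_least set_plus_mono2) (auto simp: A1_def B1_def)
  finally show ?thesis using 1 by linarith
qed

lemma clear_denominator_ineq:
  fixes x T s u v :: real
  assumes "x > 0" and "T \<ge> s * (u / x + v - 1)"
  shows "x * T \<ge> s * (u + x * (v - 1))"
proof -
  have "s * (u + x * (v - 1)) = x * (s * (u / x + v - 1))"
    using assms(1) by (simp add: right_diff_distrib distrib_left)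
  also have "\<dots> \<le> x * T"
    using assms by (intro mult_left_mono) auto
  finally show ?thesis .
qed

text \<open>The recursion averages the two ways of splitting off a last column, with weights proportional to
  \<open>\<alpha> - 1\<close> and \<open>\<beta> - 1\<close>.\<close>

theorem card_planar_sumset_ge:
  fixes A B :: "(real \<times> real) set"
  assumes "finite A" "finite B" "A \<noteq> {}" "B \<noteq> {}"
  defines "\<alpha> \<equiv> real (card (fst ` A))" and "\<beta> \<equiv> real (card (fst ` B))"
  shows "real (card (A + B)) \<ge> (\<alpha> + \<beta> - 1) * (real (card A) / \<alpha> + real (card B) / \<beta> - 1)"
  using assms(1-4) unfolding \<alpha>_def \<beta>_def
proof (induction "card (fst ` A) + card (fst ` B)" arbitrary: A B rule: less_induct)
  case less
  define A1 where "A1 = {x \<in> A. fst x = Max (fst ` A)}"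
  define B1 where "B1 = {x \<in> B. fst x = Max (fst ` B)}"
  define \<alpha> where "\<alpha> = card (fst ` A)"
  define \<beta> where "\<beta> = card (fst ` B)"
  let ?S = "real (card (A + B))"
  have maxin: "Max (fst ` A) \<in> fst ` A" "Max (fst ` B) \<in> fst ` B" using less.prems by auto
  have pos: "\<alpha> \<ge> 1" "\<beta> \<ge> 1" using less.prems by (auto simp: \<alpha>_def \<beta>_def Suc_le_eq card_gt_0_iff)
  have "fst ` (A - A1) = fst ` A - {Max (fst ` A)}" "fst ` (B - B1) = fst ` B - {Max (fst ` B)}"
    by (auto simp: A1_def B1_def)
  then have cols: "card (fst ` (A - A1)) = \<alpha> - 1" "card (fst ` (B - B1)) = \<beta> - 1"
    using maxin less.prems by (simp_all add: \<alpha>_def \<beta>_def card_Diff_singleton)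
  have sz: "real (card (A - A1)) = real (card A) - real (card A1)"
    "real (card (B - B1)) = real (card B) - real (card B1)"
    "card A1 \<le> card A" "card B1 \<le> card B"
    using less.prems by (auto simp: A1_def B1_def card_Diff_subset of_nat_diff card_mono)
  have top1: "real (card ((A - A1) + B)) + card A1 + card B1 \<le> ?S + 1"
    using card_sumset_top_column[OF less.prems] unfolding A1_def B1_def by linarith
  have top2: "real (card (A + (B - B1))) + card A1 + card B1 \<le> ?S + 1"
    using card_sumset_top_column[of B A] less.prems unfolding A1_def B1_def
    by (simp add: add.commute[of B] add.commute[of _ A])
  \<comment> \<open>Stated without the denominator \<open>\<alpha> - 1\<close>: for a single column,
    where \<open>A - A1\<close> is empty and induction does not apply, both sides are simply
    0.\<close>
  have step1: "real (\<alpha> - 1) * (?S + 1 - card A1 - card B1) \<ge>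
     (real \<alpha> + real \<beta> - 2) * ((real (card A) - card A1) + (real \<alpha> - 1) * (real (card B) / \<beta> - 1))"
  proof (cases "\<alpha> = 1")
    case True
    then have "A - A1 = {}" using cols less.prems by (auto simp: card_eq_0_iff)
    then have "A = A1" by (auto simp: A1_def)
    then show ?thesis using True by simp
  next
    case False
    then have "card (fst ` (A - A1)) \<noteq> 0" using cols pos by auto
    then have "A - A1 \<noteq> {}" by (metis card.empty image_empty)
    then have "real (card ((A - A1) + B)) \<ge> (real (\<alpha> - 1) + real \<beta> - 1) *
       ((real (card A) - card A1) / real (\<alpha> - 1) + real (card B) / \<beta> - 1)"
      using less.hyps[of "A - A1" B] less.prems cols pos sz False by (simp add: \<alpha>_def \<beta>_def)
    then have "?S + 1 - card A1 - card B1 \<ge> (real \<alpha> + real \<beta> - 2) *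
       ((real (card A) - card A1) / real (\<alpha> - 1) + real (card B) / \<beta> - 1)"
      using top1 pos by (simp add: of_nat_diff)
    from clear_denominator_ineq[OF _ this] pos False show ?thesis
      by (simp add: of_nat_diff)
  qed
  have step2: "real (\<beta> - 1) * (?S + 1 - card A1 - card B1) \<ge>
     (real \<alpha> + real \<beta> - 2) * ((real (card B) - card B1) + (real \<beta> - 1) * (real (card A) / \<alpha> - 1))"
  proof (cases "\<beta> = 1")
    case True
    then have "B - B1 = {}" using cols less.prems by (auto simp: card_eq_0_iff)
    then have "B = B1" by (auto simp: B1_def)
    then show ?thesis using True by simp
  next
    case False
    then have "card (fst ` (B - B1)) \<noteq> 0" using cols pos by auto
    then have "B - B1 \<noteq> {}" by (metis card.empty image_empty)
    then have "real (card (A + (B - B1))) \<ge> (real \<alpha> + real (\<beta> - 1) - 1) *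
       (real (card A) / \<alpha> + (real (card B) - card B1) / real (\<beta> - 1) - 1)"
      using less.hyps[of A "B - B1"] less.prems cols pos sz False by (simp add: \<alpha>_def \<beta>_def)
    then have "?S + 1 - card A1 - card B1 \<ge> (real \<alpha> + real \<beta> - 2) *
       ((real (card B) - card B1) / real (\<beta> - 1) + real (card A) / \<alpha> - 1)"
      using top2 pos by (simp add: of_nat_diff add.commute)
    from clear_denominator_ineq[OF _ this] pos False show ?thesis
      by (simp add: of_nat_diff)
  qed
  show ?case
  proof (cases "\<alpha> = 1 \<and> \<beta> = 1")
    case True
    then have "A - A1 = {}" "B - B1 = {}" using cols less.prems by (auto simp: card_eq_0_iff)
    then have "A = A1" "B = B1" by (auto simp: A1_def B1_def)
    then have "real (card A) + real (card B) \<le> ?S + 1" using top1 by simp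
    with True show ?thesis unfolding \<alpha>_def \<beta>_def by simp
  next
    case False
    \<comment> \<open>In the sum of \<open>step1\<close> and \<open>step2\<close> the weights on the
      left add up to \<open>s\<close>, which is also the common factor on the right. It vanishes
      only when both sets are single columns, the case just treated.\<close>
    define s where "s = real \<alpha> + real \<beta> - 2"
    have s: "s > 0" using pos False by (auto simp: s_def)
    have "s * (?S + 1 - card A1 - card B1) \<ge> s * ((real (card A) - card A1) +
       (real \<alpha> - 1) * (real (card B) / \<beta> - 1) + ((real (card B) - card B1) +
       (real \<beta> - 1) * (real (card A) / \<alpha> - 1)))"
      using step1 step2 pos by (simp add: s_def of_nat_diff algebra_simps)
    then have "?S + 1 - card A1 - card B1 \<ge> (real (card A) - card A1) +
       (real \<alpha> - 1) * (real (card B) / \<beta> - 1) + ((real (card B) - card B1) +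
       (real \<beta> - 1) * (real (card A) / \<alpha> - 1))"
      using s by simp
    moreover have "(real \<alpha> + real \<beta> - 1) * (real (card A) / \<alpha> + real (card B) / \<beta> - 1)
      = real (card A) + (real \<alpha> - 1) * (real (card B) / \<beta> - 1) + real (card B) +
       (real \<beta> - 1) * (real (card A) / \<alpha> - 1) - 1"
      using pos by (simp add: field_simps)
    ultimately show ?thesis unfolding \<alpha>_def \<beta>_def by linarith
  qed
qed


section \<open>Elementary inequalities for the numbers of columns\<close>

text \<open>Twelve times the difference of the sides is a square plus
  \<open>20 \<alpha>^2 - 60 \<alpha> - 9\<close>, which is positive from \<open>\<alpha> = 4\<close>
  on. For \<open>\<alpha> = 3\<close> the difference is
  \<open>3 (\<beta> - 2) (\<beta> - 3)\<close>, which is nonnegative because \<open>\<beta>\<close>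
  is an integer.\<close>

lemma column_quadratic_nonneg:
  fixes \<alpha> \<beta> :: nat
  assumes "\<alpha> \<ge> 3"
  shows "3 * (real \<alpha>)\<^sup>2 + 3 * (real \<beta>)\<^sup>2 \<ge> 4 * real \<alpha> * real \<beta> + 3 * real \<alpha> + 3 * real \<beta>"
proof (cases "\<alpha> = 3")
  case True
  have "(real \<beta> - 2) * (real \<beta> - 3) \<ge> 0"
  proof (cases "\<beta> \<le> 2")
    case True
    then show ?thesis by (intro mult_nonpos_nonpos) auto
  next
    case False
    then show ?thesis by (intro mult_nonneg_nonneg) auto
  qed
  then show ?thesis using True by (simp add: algebra_simps power2_eq_square)
next
  case False
  then have 4: "real \<alpha> \<ge> 4" using assms by linarith
  have "20 * real \<alpha> * (real \<alpha> - 4) \<ge> 0" using 4 by simp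
  moreover have "20 * real \<alpha> * (real \<alpha> - 4) = 20 * real \<alpha> * real \<alpha> - 80 * real \<alpha>"
    by (simp add: algebra_simps)
  ultimately have "20 * real \<alpha> * real \<alpha> - 60 * real \<alpha> - 9 \<ge> 0" using 4 by linarith
  then have "0 \<le> (6 * real \<beta> - 4 * real \<alpha> - 3)\<^sup>2 + (20 * real \<alpha> * real \<alpha> - 60 * real \<alpha> - 9)"
    by (intro add_nonneg_nonneg) auto
  also have "\<dots> = 12 * (3 * (real \<alpha>)\<^sup>2 + 3 * (real \<beta>)\<^sup>2
      - (4 * real \<alpha> * real \<beta> + 3 * real \<alpha> + 3 * real \<beta>))"
    by (simp add: algebra_simps power2_eq_square)
  finally show ?thesis by simp
qed

text \<open>For fixed \<open>n\<close> the difference of the sides is linear in \<open>m\<close>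
  with slope \<open>c\<close>, so its minimum is at \<open>m = \<beta>\<close> or at
  \<open>m = n\<close>, according to the sign of \<open>c\<close>. Then
  \<open>n / \<alpha> \<ge> 4\<close> leaves inequalities in the column counts alone.\<close>

lemma column_inequality:
  fixes \<alpha> \<beta> :: nat and n m :: real
  assumes "\<alpha> \<ge> 3" "\<beta> \<ge> 1" "real \<beta> \<le> m" "m \<le> n" "4 * real \<alpha> \<le> n"
  shows "(real \<alpha> + real \<beta> - 1) * (n / \<alpha> + m / \<beta> - 1) \<ge> n + 7 / 3 * m - 16"
proof -
  define a b where "a = real \<alpha>" and "b = real \<beta>"
  have ab: "a \<ge> 3" "b \<ge> 1" "b \<le> m" "4 * a \<le> n" using assms by (auto simp: a_def b_def)
  define c where "c = (a - 1) / b - 4 / 3"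
  have expand: "(a + b - 1) * (n / a + m / b - 1) - n - 7 / 3 * m + 16
      = n / a * (b - 1) + m * c - a - b + 17"
    using ab by (simp add: c_def field_simps)
  define u v where "u = n / a * (b - 1)" and "v = m * c"
  have "u + v - a - b + 17 \<ge> 0"
  proof (cases "c \<ge> 0")
    case True
    have "n / a \<ge> 4" using ab by (simp add: field_simps)
    then have "u \<ge> 4 * (b - 1)" unfolding u_def using ab by (intro mult_right_mono) auto
    moreover have "b * c = a - 1 - 4 / 3 * b" using ab by (simp add: c_def field_simps)
    then have "v \<ge> a - 1 - 4 / 3 * b"
      unfolding v_def using mult_right_mono[of b m c] True ab by simp
    ultimately show ?thesis using ab by (simp add: algebra_simps)
  next
    case False
    then have small: "3 * a < 4 * b + 3" using ab by (simp add: c_def field_simps)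
    \<comment> \<open>Replacing \<open>m\<close> by \<open>n\<close> turns \<open>u + v\<close> into
      \<open>n / a * q\<close>. Nonnegativity of \<open>q\<close>, which is the quadratic lemma
      divided by \<open>3 * b\<close>, is what allows \<open>n / a\<close> to be lowered to
      4.\<close>
    define q where "q = (b - 1) + a * c"
    have qb: "3 * (q * b) = 3 * (a)\<^sup>2 + 3 * (b)\<^sup>2 - 4 * a * b - 3 * a - 3 * b"
      using ab by (simp add: q_def c_def field_simps power2_eq_square)
    then have "q * b \<ge> 0" using column_quadratic_nonneg[of \<alpha> \<beta>] assms by (simp add: a_def b_def)
    then have q0: "q \<ge> 0" using ab by (simp add: zero_le_mult_iff)
    have "v \<ge> n * c" unfolding v_def using False assms by (intro mult_right_mono_neg) auto
    moreover have "u + n * c = n / a * q" using ab by (simp add: u_def q_def field_simps)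
    moreover have "n / a * q \<ge> 4 * q" using q0 ab by (intro mult_right_mono) (auto simp: field_simps)
    moreover have "4 * q - a - b + 17 \<ge> 0"
    proof -
      have "3 * b * (4 * q - a - b + 17) = 12 * (a)\<^sup>2 + 9 * (b)\<^sup>2 - 19 * a * b - 12 * a + 39 * b"
        using qb by (simp add: algebra_simps power2_eq_square)
      \<comment> \<open>Completing the square in \<open>b\<close> leaves
        \<open>12 - 361/36 = 71/36\<close> as coefficient of \<open>a^2\<close>; the linear part is
        positive because \<open>c < 0\<close> means \<open>3 * a < 4 * b + 3\<close>.\<close>
      also have "\<dots> = (9 * (b - 19 / 18 * a)\<^sup>2 + 71 / 36 * (a)\<^sup>2) + (39 * b - 12 * a)"
        by (simp add: algebra_simps power2_eq_square)
      also have "\<dots> \<ge> 0" using small ab by (intro add_nonneg_nonneg) auto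
      finally show ?thesis using ab by (simp add: zero_le_mult_iff)
    qed
    ultimately show ?thesis by linarith
  qed
  then show ?thesis using expand by (simp add: a_def b_def u_def v_def)
qed

corollary card_planar_sumset_ge_linear:
  fixes A B :: "(real \<times> real) set"
  assumes "finite A" "finite B" "B \<noteq> {}" "card B \<le> card A"
    and "card (fst ` A) \<ge> 3" "4 * card (fst ` A) \<le> card A"
  shows "real (card (A + B)) \<ge> real (card A) + 7 / 3 * real (card B) - 16"
proof -
  have "A \<noteq> {}" using assms(5) by auto
  moreover have "card (fst ` B) \<ge> 1" using assms by (auto simp: Suc_le_eq card_gt_0_iff)
  moreover have "card (fst ` B) \<le> card B" using assms by (simp add: card_image_le)
  ultimately show ?thesis
    using column_inequality[of "card (fst ` A)" "card (fst ` B)" "card B" "card A"]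
      card_planar_sumset_ge[of A B] assms by linarith
qed

subsection \<open>Compressions\<close>

text \<open>When \<open>w $ i = 1\<close> this is the linear projection along \<open>w\<close> onto
  the hyperplane of vanishing \<open>i\<close>-th coordinate, so its fibres are the lines in
  direction \<open>w\<close>.\<close>

definition slide :: "'n \<Rightarrow> real ^ 'n \<Rightarrow> real ^ 'n \<Rightarrow> real ^ ('n::finite)" where
  "slide i w x = x - (x $ i) *\<^sub>R w"

text \<open>On every line in direction \<open>w\<close> (where \<open>w $ i = 1\<close>), the points of \<open>A\<close> are replaced by the same
  number of points with \<open>i\<close>-th coordinates \<open>0, 1, 2, \<dots>\<close>.\<close>

definition compress :: "'n \<Rightarrow> real ^ 'n \<Rightarrow> (real ^ 'n) set \<Rightarrow> (real ^ ('n::finite)) set" where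
  "compress i w A = {y. y $ i \<in> \<nat> \<and> y $ i < real (card {x \<in> A. slide i w x = slide i w y})}"

lemma slide_add: "slide i w (x + y) = slide i w x + slide i w y"
  by (simp add: slide_def algebra_simps)

lemma slide_diff: "slide i w (x - y) = slide i w x - slide i w y"
  by (simp add: slide_def algebra_simps)

lemma slide_zero [simp]: "slide i w 0 = 0"
  by (simp add: slide_def)

lemma slide_scaleR: "slide i w (c *\<^sub>R x) = c *\<^sub>R slide i w x"
  by (simp add: slide_def algebra_simps)

lemma slide_self: "w $ i = 1 \<Longrightarrow> slide i w w = 0"
  by (simp add: slide_def)

lemma slide_nth: "slide i w x $ j = x $ j - x $ i * w $ j"
  by (simp add: slide_def)

lemma slide_slide: "w $ i = 1 \<Longrightarrow> slide i w (slide i w x) = slide i w x"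
  by (simp add: slide_def)

lemma slide_inj: "slide i w x = slide i w y \<Longrightarrow> x $ i = y $ i \<Longrightarrow> x = y"
  by (simp add: slide_def)

lemma inj_on_fibre: "inj_on (\<lambda>x. x $ i) {x \<in> A. slide i w x = p}"
  by (auto intro!: inj_onI dest: slide_inj)

text \<open>The condition on \<open>p\<close> puts it on the hyperplane of vanishing
  \<open>i\<close>-th coordinate, so \<open>p\<close> is the first point of its compressed line and
  the others follow in steps of \<open>w\<close>.\<close>

lemma fibre_compress:
  assumes "w $ i = 1" and "slide i w p = p"
  shows "{y \<in> compress i w A. slide i w y = p}
    = (\<lambda>k. p + real k *\<^sub>R w) ` {..<card {x \<in> A. slide i w x = p}}"
proof -
  have pi: "p $ i = 0" using arg_cong[OF assms(2), of "\<lambda>x. x $ i"] assms(1) by (simp add: slide_nth)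
  show ?thesis
  proof (intro equalityI subsetI)
    fix y assume y: "y \<in> {y \<in> compress i w A. slide i w y = p}"
    then obtain k :: nat where k: "y $ i = real k" by (auto simp: compress_def elim: Nats_cases)
    then have "y = p + real k *\<^sub>R w" using y by (auto simp: slide_def)
    then show "y \<in> (\<lambda>k. p + real k *\<^sub>R w) ` {..<card {x \<in> A. slide i w x = p}}"
      using y k by (auto simp: compress_def)
  next
    fix y assume "y \<in> (\<lambda>k. p + real k *\<^sub>R w) ` {..<card {x \<in> A. slide i w x = p}}"
    then obtain k where k: "k < card {x \<in> A. slide i w x = p}" "y = p + real k *\<^sub>R w" by auto
    have "slide i w y = p" using k assms by (simp add: slide_add slide_scaleR slide_self)
    then show "y \<in> {y \<in> compress i w A. slide i w y = p}"
      using k assms pi by (auto simp: compress_def)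
  qed
qed

lemma card_fibre_compress:
  assumes "w $ i = 1"
  shows "card {y \<in> compress i w A. slide i w y = p} = card {x \<in> A. slide i w x = p}"
proof (cases "slide i w p = p")
  case True
  have "w \<noteq> 0" using assms by auto
  then have "inj (\<lambda>k. p + real k *\<^sub>R w)" by (auto intro!: injI)
  then have "inj_on (\<lambda>k. p + real k *\<^sub>R w) {..<card {x \<in> A. slide i w x = p}}"
    using inj_on_subset by blast
  then show ?thesis using True assms by (simp add: fibre_compress card_image)
next
  case False
  then have "{y. slide i w y = p} = {}" using slide_slide[OF assms] by auto
  then show ?thesis by (metis (no_types, lifting) Collect_empty_eq card.empty)
qed

lemma slide_compress_subset: "slide i w ` compress i w A \<subseteq> slide i w ` A"
proof
  fix p assume "p \<in> slide i w ` compress i w A"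
  then obtain y where y: "y \<in> compress i w A" "p = slide i w y" by auto
  have "card {x \<in> A. slide i w x = p} \<noteq> 0" using y by (auto simp: compress_def elim!: Nats_cases)
  then have "{x \<in> A. slide i w x = p} \<noteq> {}" by force
  then show "p \<in> slide i w ` A" by auto
qed

lemma finite_compress:
  assumes "finite A" and "w $ i = 1"
  shows "finite (compress i w A)"
proof (rule finite_subset)
  show "compress i w A \<subseteq> (\<Union>p\<in>slide i w ` A. {y \<in> compress i w A. slide i w y = p})"
  proof
    fix y assume "y \<in> compress i w A"
    moreover from this have "slide i w y \<in> slide i w ` A"
      by (rule subsetD[OF slide_compress_subset imageI])
    ultimately show "y \<in> (\<Union>p\<in>slide i w ` A. {y \<in> compress i w A. slide i w y = p})"
      by auto
  qed
  have "finite {y \<in> compress i w A. slide i w y = p}" if p: "p \<in> slide i w ` A" for p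
  proof -
    obtain x where "p = slide i w x" using p by (rule imageE)
    then have "slide i w p = p" by (simp add: slide_slide[OF assms(2)])
    then show ?thesis
      unfolding fibre_compress[OF assms(2) \<open>slide i w p = p\<close>] by (intro finite_imageI finite_lessThan)
  qed
  then show "finite (\<Union>p\<in>slide i w ` A. {y \<in> compress i w A. slide i w y = p})"
    using assms(1) by (intro finite_UN_I finite_imageI) auto
qed

lemma slide_in_compress:
  assumes "finite A" "w $ i = 1" "x \<in> A"
  shows "slide i w x \<in> compress i w A"
proof -
  have "{y \<in> A. slide i w y = slide i w x} \<noteq> {}" using assms by auto
  then have "card {y \<in> A. slide i w y = slide i w x} > 0" using assms by (simp add: card_gt_0_iff)
  then show ?thesis using assms by (simp add: compress_def slide_slide slide_nth)
qed

lemma in_compress_of_coord_zero: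
  assumes "finite A" "w $ i = 1" "x \<in> A" "x $ i = 0"
  shows "x \<in> compress i w A"
  using slide_in_compress[OF assms(1-3)] assms(4) by (simp add: slide_def)

text \<open>A line with at least two points of \<open>A\<close> keeps its positions 0 and 1; this is
  position 1.\<close>

lemma slide_plus_in_compress:
  assumes "finite A" "w $ i = 1" "x \<in> A" "y \<in> A" "x \<noteq> y" "slide i w x = slide i w y"
  shows "slide i w x + w \<in> compress i w A"
proof -
  have "card {x, y} \<le> card {z \<in> A. slide i w z = slide i w x}" using assms by (intro card_mono) auto
  then show ?thesis using assms by (simp add: compress_def slide_slide slide_nth slide_add slide_self)
qed

lemma sum_compress_fibres:
  assumes "finite A" "w $ i = 1"
  shows "sum g (compress i w A)
    = (\<Sum>p\<in>slide i w ` A. \<Sum>y\<in>{y \<in> compress i w A. slide i w y = p}. g y)"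
  by (rule sum.group[symmetric, OF finite_compress[OF assms] finite_imageI[OF assms(1)] slide_compress_subset])

text \<open>Compression moves points along lines but keeps the number on each line, so every
  statistic that is constant along the lines survives. Cardinalities are special cases.\<close>

lemma sum_compress:
  fixes h :: "real ^ 'n \<Rightarrow> nat"
  assumes "finite A" "w $ i = 1"
  shows "(\<Sum>y\<in>compress i w A. h (slide i w y)) = (\<Sum>x\<in>A. h (slide i w x))"
proof -
  let ?S = "slide i w ` A"
  have inner: "(\<Sum>y\<in>{y \<in> C. slide i w y = p}. h (slide i w y))
      = card {y \<in> C. slide i w y = p} * h p" for C p
    by (simp add: sum.cong[of _ _ "\<lambda>y. h (slide i w y)" "\<lambda>_. h p"])
  have "(\<Sum>y\<in>compress i w A. h (slide i w y))
    = (\<Sum>p\<in>?S. \<Sum>y\<in>{y \<in> compress i w A. slide i w y = p}. h (slide i w y))"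
    by (rule sum_compress_fibres[OF assms])
  also have "\<dots> = (\<Sum>p\<in>?S. \<Sum>x\<in>{x \<in> A. slide i w x = p}. h (slide i w x))"
    unfolding inner card_fibre_compress[OF assms(2)] ..
  also have "\<dots> = (\<Sum>x\<in>A. h (slide i w x))"
    by (rule sum.image_gen[symmetric, OF assms(1)])
  finally show ?thesis .
qed

lemma card_Collect_compress:
  assumes "finite A" "w $ i = 1"
  shows "card {y \<in> compress i w A. Q (slide i w y)} = card {x \<in> A. Q (slide i w x)}"
  using sum_compress[OF assms, of "\<lambda>p. if Q p then 1 else 0"] assms
  by (simp add: sum.If_cases finite_compress Int_def)

lemma card_compress: "finite A \<Longrightarrow> w $ i = 1 \<Longrightarrow> card (compress i w A) = card A"
  using sum_compress[of A w i "\<lambda>_. 1"] by simp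

text \<open>Positions \<open>k < card F\<close> and \<open>l < card G\<close> give
  \<open>k + l \<le> card F + card G - 2\<close>, which is below \<open>card (F + G)\<close> by the
  one-dimensional bound; hence position \<open>k + l\<close> is occupied in the compressed
  sumset.\<close>

lemma compress_plus_subset:
  assumes "finite A" "finite B" "w $ i = 1"
  shows "compress i w A + compress i w B \<subseteq> compress i w (A + B)"
proof
  fix t assume "t \<in> compress i w A + compress i w B"
  then obtain x y where xy: "x \<in> compress i w A" "y \<in> compress i w B" "t = x + y"
    unfolding set_plus_def by blast
  define F G where "F = {a \<in> A. slide i w a = slide i w x}" and "G = {b \<in> B. slide i w b = slide i w y}"
  obtain k l :: nat where kl: "x $ i = real k" "y $ i = real l" "k < card F" "l < card G"
    using xy by (auto simp: compress_def F_def G_def elim!: Nats_cases)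
  have fin: "finite F" "finite G" using assms by (auto simp: F_def G_def)
  have "F \<noteq> {}" "G \<noteq> {}" using kl by auto
  then have "card F + card G \<le> card (F + G) + 1"
    using fin by (intro card_sumset_ge_of_inj[where f = "\<lambda>x. x $ i"])
      (auto simp: F_def G_def inj_on_fibre)
  also have "F + G \<subseteq> {c \<in> A + B. slide i w c = slide i w t}"
    using xy by (auto simp: F_def G_def slide_add elim!: set_plus_elim intro!: set_plus_intro)
  then have "card (F + G) \<le> card {c \<in> A + B. slide i w c = slide i w t}"
    using assms by (intro card_mono) (auto simp: finite_set_plus)
  finally show "t \<in> compress i w (A + B)"
    using kl xy by (auto simp: compress_def)
qed

lemma card_compress_plus_le:
  assumes "finite A" "finite B" "w $ i = 1"
  shows "card (compress i w A + compress i w B) \<le> card (A + B)"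
  using card_mono[OF finite_compress compress_plus_subset[OF assms]] assms
  by (simp add: finite_set_plus card_compress)

lemma card_fibre_slide_le:
  assumes "finite A" "w $ i = 1" "i \<noteq> z"
  defines "\<pi> \<equiv> slide z (axis z 1)"
  shows "card (\<pi> ` compress i w A) \<le> card (\<pi> ` A)"
proof -
  have coord: "\<pi> x $ i = x $ i" for x using assms(3) by (simp add: \<pi>_def slide_nth axis_def)
  have comm: "slide i (\<pi> w) (\<pi> x) = \<pi> (slide i w x)" for x
    using coord assms(3) by (simp add: slide_def \<pi>_def algebra_simps vec_eq_iff axis_def)
  have "\<pi> ` compress i w A \<subseteq> compress i (\<pi> w) (\<pi> ` A)"
  proof
    fix t assume "t \<in> \<pi> ` compress i w A"
    then obtain y where y: "y \<in> compress i w A" "t = \<pi> y" by auto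
    have "inj_on \<pi> {x \<in> A. slide i w x = slide i w y}"
      using coord by (intro inj_onI) (metis (mono_tags, lifting) mem_Collect_eq slide_inj)
    then have "card {x \<in> A. slide i w x = slide i w y} = card (\<pi> ` {x \<in> A. slide i w x = slide i w y})"
      by (simp add: card_image)
    also have "\<dots> \<le> card {x \<in> \<pi> ` A. slide i (\<pi> w) x = slide i (\<pi> w) t}"
      using assms(1) y comm by (intro card_mono) auto
    finally show "t \<in> compress i (\<pi> w) (\<pi> ` A)" using y coord by (auto simp: compress_def)
  qed
  moreover have "\<pi> w $ i = 1" using coord assms by simp
  ultimately show ?thesis
    using card_mono[OF finite_compress[of "\<pi> ` A" "\<pi> w" i]] card_compress[of "\<pi> ` A" "\<pi> w" i] assms(1)
    by (metis finite_imageI)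
qed

text \<open>The induction adds the largest element, which is at least the number of the others. The
  equality clause is what makes a compression that changes something lower the coordinate sum
  strictly.\<close>

lemma sum_lessThan_card_le:
  fixes T :: "nat set"
  assumes "finite T"
  shows "\<Sum>{..<card T} \<le> \<Sum>T \<and> (\<Sum>{..<card T} = \<Sum>T \<longrightarrow> T = {..<card T})"
  using assms
proof (induction T rule: finite_linorder_max_induct)
  case empty
  then show ?case by simp
next
  case (insert b T)
  then have "T \<subseteq> {..<b}" by auto
  then have c: "card T \<le> b" using card_mono[of "{..<b}" T] by simp
  have b: "b \<notin> T" using insert by auto
  have e: "\<Sum>{..<card (insert b T)} = \<Sum>{..<card T} + card T" "\<Sum>(insert b T) = \<Sum>T + b"
    "card (insert b T) = Suc (card T)"
    using insert.hyps b by (simp_all add: add.commute)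
  show ?case
  proof (intro conjI impI)
    show "\<Sum>{..<card (insert b T)} \<le> \<Sum>(insert b T)" using e insert.IH c by linarith
    assume "\<Sum>{..<card (insert b T)} = \<Sum>(insert b T)"
    then have "card T = b" "\<Sum>{..<card T} = \<Sum>T" using e insert.IH c by linarith+
    then have "T = {..<b}" using insert.IH by simp
    then show "insert b T = {..<card (insert b T)}" using e by auto
  qed
qed

lemma sum_coord_compress_le:
  assumes "finite A" "w $ i = 1" "\<And>x. x \<in> A \<Longrightarrow> x $ i \<in> \<nat>"
  defines "v \<equiv> \<lambda>x. nat \<lfloor>x $ i\<rfloor>"
  shows "(\<Sum>y\<in>compress i w A. v y) \<le> (\<Sum>x\<in>A. v x)"
    and "x \<in> A \<Longrightarrow> x $ i \<ge> 1 \<Longrightarrow> x - w \<notin> A \<Longrightarrow> (\<Sum>y\<in>compress i w A. v y) < (\<Sum>x\<in>A. v x)"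
proof -
  define F where "F p = {x \<in> A. slide i w x = p}" for p
  define L where "L p = (\<Sum>y\<in>{y \<in> compress i w A. slide i w y = p}. v y)" for p
  have v: "real (v x) = x $ i" if "x \<in> A" for x
    using assms(3)[OF that] by (auto simp: v_def elim!: Nats_cases)
  have inj: "inj_on v (F p)" for p
    using v by (intro inj_onI) (metis (mono_tags, lifting) F_def mem_Collect_eq slide_inj)
  have finF: "finite (F p)" for p using assms by (simp add: F_def)
  have R: "(\<Sum>x\<in>F p. v x) = \<Sum>(v ` F p)" for p using inj by (simp add: sum.reindex)
  have Lp: "L p = \<Sum>{..<card (v ` F p)}" if "p \<in> slide i w ` A" for p
  proof -
    have p: "slide i w p = p" using that assms by (auto simp: slide_slide)
    have pi: "p $ i = 0" using that assms by (auto simp: slide_nth)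
    have "w \<noteq> 0" using assms(2) by auto
    then have "inj_on (\<lambda>k. p + real k *\<^sub>R w) {..<card (F p)}" by (auto intro!: inj_onI)
    then have "L p = (\<Sum>k<card (F p). v (p + real k *\<^sub>R w))"
      unfolding L_def fibre_compress[OF assms(2) p] by (simp add: sum.reindex F_def)
    also have "\<dots> = \<Sum>{..<card (F p)}" using pi assms(2) by (simp add: v_def)
    finally show ?thesis using inj by (simp add: card_image)
  qed
  have sumL: "(\<Sum>y\<in>compress i w A. v y) = (\<Sum>p\<in>slide i w ` A. L p)"
    unfolding L_def by (rule sum_compress_fibres[OF assms(1,2)])
  have sumR: "(\<Sum>x\<in>A. v x) = (\<Sum>p\<in>slide i w ` A. \<Sum>(v ` F p))"
    using sum.image_gen[OF assms(1), of v "slide i w"] R by (simp add: F_def)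
  have le: "L p \<le> \<Sum>(v ` F p)" if "p \<in> slide i w ` A" for p
    using sum_lessThan_card_le[of "v ` F p"] finF Lp[OF that] by simp
  show "(\<Sum>y\<in>compress i w A. v y) \<le> (\<Sum>x\<in>A. v x)"
    unfolding sumL sumR by (intro sum_mono le)
  show "(\<Sum>y\<in>compress i w A. v y) < (\<Sum>x\<in>A. v x)" if x: "x \<in> A" "x $ i \<ge> 1" "x - w \<notin> A"
  proof -
    let ?p = "slide i w x"
    \<comment> \<open>An initial segment containing \<open>v x\<close> would also contain
      \<open>v x - 1\<close>, but the only point of this line with that coordinate is
      \<open>x - w\<close>, which is absent.\<close>
    have "v ` F ?p \<noteq> {..<card (v ` F ?p)}"
    proof
      assume eq: "v ` F ?p = {..<card (v ` F ?p)}"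
      have "v x \<in> v ` F ?p" using x by (auto simp: F_def)
      then have "v x < card (v ` F ?p)" using eq by auto
      then have "v x - 1 \<in> {..<card (v ` F ?p)}" by simp
      then have "v x - 1 \<in> v ` F ?p" using eq by simp
      then obtain y where y: "y \<in> F ?p" "v y = v x - 1" by auto
      have "v x \<ge> 1" using v[OF x(1)] x(2) by linarith
      then have "real (v y) = real (v x) - 1" using y by simp
      then have "y $ i = x $ i - 1" using v[OF x(1)] v[of y] y by (simp add: F_def)
      then have "y = x - w"
        using y assms(2)
        by (auto intro: slide_inj[of i w] simp: F_def slide_diff slide_self)
      then show False using y x by (auto simp: F_def)
    qed
    then have "L ?p < \<Sum>(v ` F ?p)"
      using sum_lessThan_card_le[of "v ` F ?p"] finF Lp[of ?p] x by (simp add: less_le)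
    then show ?thesis unfolding sumL sumR using le assms(1) x by (intro sum_strict_mono_ex1) auto
  qed
qed

subsection \<open>Reductions by compression\<close>

text \<open>This is the number of lines in direction \<open>axis z 1\<close> that meet
  \<open>A\<close>, each line being represented by its point in the hyperplane of vanishing
  \<open>z\<close>-th coordinate.\<close>

definition column_count :: "'n \<Rightarrow> (real ^ 'n) set \<Rightarrow> nat" where
  "column_count z A = card (slide z (axis z 1) ` A)"

text \<open>The inequalities point so that a lower bound for the new sumset passes back to the old
  one, while an upper bound on columns passes forward.\<close>

definition reduces_to ::
  "'n \<Rightarrow> (real ^ 'n) set \<Rightarrow> (real ^ 'n) set \<Rightarrow> (real ^ 'n) set \<Rightarrow> (real ^ ('n::finite)) set \<Rightarrow> bool" where
  "reduces_to z A B A' B' \<longleftrightarrow> finite A' \<and> finite B' \<and> card A' = card A \<and> card B' = card B \<and>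
     card (A' + B') \<le> card (A + B) \<and> column_count z A' \<le> column_count z A"

lemma reduces_to_refl: "finite A \<Longrightarrow> finite B \<Longrightarrow> reduces_to z A B A B"
  by (simp add: reduces_to_def)

lemma reduces_to_trans: "reduces_to z A B A' B' \<Longrightarrow> reduces_to z A' B' A'' B'' \<Longrightarrow> reduces_to z A B A'' B''"
  by (auto simp: reduces_to_def)

text \<open>Two kinds of direction do not create columns: those whose pivot coordinate
  \<open>i\<close> survives projection along \<open>axis z 1\<close>, and the column direction
  itself.\<close>

lemma reduces_to_compress:
  assumes "finite A" "finite B" "w $ i = 1" "i \<noteq> z \<or> w = axis z 1"
  shows "reduces_to z A B (compress i w A) (compress i w B)"
proof -
  have "column_count z (compress i w A) \<le> column_count z A"
  proof (cases "i = z")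
    case True
    then show ?thesis using assms slide_compress_subset[of z "axis z 1" A]
      unfolding column_count_def by (auto intro!: card_mono)
  next
    case False
    then show ?thesis using assms unfolding column_count_def by (intro card_fibre_slide_le)
  qed
  then show ?thesis using assms
    by (simp add: reduces_to_def finite_compress card_compress card_compress_plus_le)
qed

lemma reduces_to_compress_trans:
  assumes "reduces_to z A B A' B'" "w $ i = 1" "i \<noteq> z \<or> w = axis z 1"
  shows "reduces_to z A B (compress i w A') (compress i w B')"
  using reduces_to_trans[OF assms(1) reduces_to_compress] assms by (auto simp: reduces_to_def)

text \<open>A coordinate on which \<open>w\<close> vanishes is constant along each line, so
  compression gives it no new values.\<close>

lemma compress_coord:
  assumes "y \<in> compress i w A" "w $ j = 0"
  obtains x where "x \<in> A" "x $ j = y $ j"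
proof -
  have "slide i w y \<in> slide i w ` A" using assms(1) slide_compress_subset by blast
  then obtain x where "x \<in> A" "slide i w y = slide i w x" by auto
  then show thesis using that[of x] assms(2) by (metis diff_zero mult_zero_right slide_nth)
qed

subsection \<open>Thin sets\<close>

text \<open>The potential that the exchange compressions lower. Rounding makes it a natural number,
  so that minima exist; on points with natural \<open>J\<close>-coordinates it is their exact
  sum.\<close>

definition height :: "'n set \<Rightarrow> real ^ ('n::finite) \<Rightarrow> nat" where
  "height J x = (\<Sum>j\<in>J. nat \<lfloor>x $ j\<rfloor>)"

definition base :: "'n set \<Rightarrow> (real ^ 'n) set \<Rightarrow> (real ^ ('n::finite)) set" where
  "base J A = {x \<in> A. \<forall>j\<in>J. x $ j = 0}"

text \<open>The extremal configurations of the compressions used below: wherever \<open>e\<^sub>j\<close> can be subtracted,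
  it can be traded for any point of \<open>P\<close>.\<close>

definition exchange_closed :: "'n set \<Rightarrow> (real ^ 'n) set \<Rightarrow> (real ^ ('n::finite)) set \<Rightarrow> bool" where
  "exchange_closed J P A \<longleftrightarrow>
     (\<forall>x\<in>A. \<forall>j\<in>J. x $ j \<in> \<nat> \<and> (x $ j \<ge> 1 \<longrightarrow> (\<forall>v\<in>P. x - axis j 1 + v \<in> A)))"

text \<open>Within \<open>J\<close> only coordinate \<open>j\<close> varies along the lines, so the
  remaining part of the height is a function of the line and its total is preserved; coordinate
  \<open>j\<close> obeys the previous bounds.\<close>

lemma sum_height_compress_le:
  fixes A :: "(real ^ 'n) set"
  assumes "finite A" "w $ j = 1" "j \<in> J" "\<And>i. i \<in> J \<Longrightarrow> i \<noteq> j \<Longrightarrow> w $ i = 0"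
    and nats: "\<And>x. x \<in> A \<Longrightarrow> x $ j \<in> \<nat>"
  shows "sum (height J) (compress j w A) \<le> sum (height J) A"
    and "x \<in> A \<Longrightarrow> x $ j \<ge> 1 \<Longrightarrow> x - w \<notin> A \<Longrightarrow> sum (height J) (compress j w A) < sum (height J) A"
proof -
  define h where "h p = (\<Sum>i\<in>J - {j}. nat \<lfloor>p $ i\<rfloor>)" for p :: "real ^ 'n"
  have "h (slide j w x) = h x" for x
    unfolding h_def using assms(4) by (intro sum.cong) (auto simp: slide_nth)
  then have "height J x = nat \<lfloor>x $ j\<rfloor> + h (slide j w x)" for x
    unfolding height_def using assms(3) by (simp add: h_def sum.remove[of J j])
  then have split: "sum (height J) X = (\<Sum>x\<in>X. nat \<lfloor>x $ j\<rfloor>) + (\<Sum>x\<in>X. h (slide j w x))" for X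
    by (simp add: sum.distrib)
  note same = sum_compress[OF assms(1,2), of h]
  show "sum (height J) (compress j w A) \<le> sum (height J) A"
    using sum_coord_compress_le(1)[OF assms(1,2) nats] unfolding split same by simp
  show "sum (height J) (compress j w A) < sum (height J) A"
    if "x \<in> A" "x $ j \<ge> 1" "x - w \<notin> A"
    using sum_coord_compress_le(2)[OF assms(1,2) nats that] unfolding split same by simp
qed

lemma height_add_base:
  assumes "\<And>j. j \<in> J \<Longrightarrow> v $ j = 0" "j \<in> J" "x $ j \<ge> 1"
  shows "height J x = Suc (height J (x - axis j 1 + v))"
proof -
  have fin: "finite J" by simp
  have "(\<Sum>i\<in>J - {j}. nat \<lfloor>(x - axis j 1 + v) $ i\<rfloor>) = (\<Sum>i\<in>J - {j}. nat \<lfloor>x $ i\<rfloor>)"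
    using assms(1) by (intro sum.cong) (auto simp: axis_def)
  moreover have "nat \<lfloor>x $ j\<rfloor> = Suc (nat \<lfloor>(x - axis j 1 + v) $ j\<rfloor>)"
    using assms by (simp add: axis_def) linarith
  ultimately show ?thesis unfolding height_def using assms(2) by (simp add: sum.remove[OF fin assms(2)])
qed

lemma height_eq_0_iff:
  assumes "\<And>j. j \<in> J \<Longrightarrow> x $ j \<in> \<nat>"
  shows "height J x = 0 \<longleftrightarrow> (\<forall>j\<in>J. x $ j = 0)"
proof -
  have "nat \<lfloor>x $ j\<rfloor> = 0 \<longleftrightarrow> x $ j = 0" if "j \<in> J" for j
    using assms[OF that] by (auto elim!: Nats_cases)
  then show ?thesis by (simp add: height_def)
qed

lemma height_pos:
  assumes "height J x \<noteq> 0"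
  obtains j where "j \<in> J" "x $ j \<ge> 1"
proof -
  obtain j where "j \<in> J" "nat \<lfloor>x $ j\<rfloor> \<noteq> 0" using assms unfolding height_def by (meson sum.neutral)
  then show thesis using that[of j] by linarith
qed

lemma base_iff_height:
  assumes "exchange_closed J P A" "x \<in> A"
  shows "x \<in> base J A \<longleftrightarrow> height J x = 0"
  using assms by (subst height_eq_0_iff) (auto simp: exchange_closed_def base_def)

lemma exchange_height_one:
  assumes "exchange_closed J P A" "P \<subseteq> base J Q" "x \<in> A" "j \<in> J" "x $ j \<ge> 1" "height J x = 1"
  shows "(+) (x - axis j 1) ` P \<subseteq> base J A"
proof
  fix y assume "y \<in> (+) (x - axis j 1) ` P"
  then obtain v where v: "v \<in> P" "y = x - axis j 1 + v" by auto
  then have "y \<in> A" using assms by (auto simp: exchange_closed_def)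
  moreover have "height J y = 0"
    using height_add_base[of J v j x] v assms by (auto simp: base_def)
  ultimately show "y \<in> base J A" using base_iff_height[OF assms(1)] by simp
qed

text \<open>By counting, the translate equals \<open>P\<close>; comparing the sums of all points
  gives \<open>card P\<close> times \<open>u\<close> equal to 0.\<close>

lemma translate_subset_finite:
  fixes P :: "'a::real_vector set"
  assumes "finite P" "P \<noteq> {}" "(+) u ` P \<subseteq> P"
  shows "u = 0"
proof -
  have "card ((+) u ` P) = card P" by (simp add: card_image)
  then have eq: "(+) u ` P = P" using assms by (simp add: card_subset_eq)
  have "(\<Sum>x\<in>P. x) = (\<Sum>x\<in>(+) u ` P. x)" using eq by simp
  also have "\<dots> = (\<Sum>x\<in>P. u + x)" by (simp add: sum.reindex)
  also have "\<dots> = real (card P) *\<^sub>R u + (\<Sum>x\<in>P. x)"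
    by (simp add: sum.distrib scaleR_conv_of_real sum_constant_scaleR)
  finally have "real (card P) *\<^sub>R u = 0" by simp
  then show ?thesis using assms by simp
qed

text \<open>At height one, trading \<open>axis j 1\<close> translates the base into itself, so the
  translation is zero and the point is \<open>axis j 1\<close>. At height two, trading one unit for
  0 and for \<open>axis a 1\<close> gives two different points of height one with the same
  \<open>J\<close>-coordinates, which is impossible. Greater heights descend to height two.\<close>

lemma exchange_closed_self:
  assumes ex: "exchange_closed J (base J A) A" and fin: "finite A"
    and "0 \<in> A" and a: "axis a 1 \<in> A" "a \<notin> J" and x: "x \<in> A"
  shows "x \<in> base J A \<or> (\<exists>j\<in>J. x = axis j 1)"
proof -
  have zero: "0 \<in> base J A" and ea: "axis a 1 \<in> base J A"
    using assms by (auto simp: base_def axis_def)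
  have one: "y = axis j 1" if "y \<in> A" "j \<in> J" "y $ j \<ge> 1" "height J y = 1" for y j
  proof -
    have "y - axis j 1 = 0"
      using exchange_height_one[OF ex subset_refl that] fin zero
      by (intro translate_subset_finite[of "base J A"]) (auto simp: base_def)
    then show ?thesis by simp
  qed
  \<comment> \<open>The form \<open>Suc (Suc k)\<close> expresses height at least two; the step
    trades one unit for 0.\<close>
  have many: "height J y \<noteq> Suc (Suc k)" if "y \<in> A" for y k
    using that
  proof (induction k arbitrary: y)
    case 0
    show ?case
    proof
      assume h: "height J y = Suc (Suc 0)"
      then obtain j where j: "j \<in> J" "y $ j \<ge> 1" using height_pos[of J y] by auto
      have trade: "y - axis j 1 + v \<in> A \<and> height J (y - axis j 1 + v) = 1" if "v \<in> base J A" for v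
        using that ex 0 j h height_add_base[of J v j y] by (auto simp: exchange_closed_def base_def)
      obtain i where i: "i \<in> J" "(y - axis j 1 + 0) $ i \<ge> 1"
        using trade[OF zero] height_pos[of J "y - axis j 1 + 0"] by auto
      then have "(y - axis j 1 + axis a 1) $ i \<ge> 1" using a(2) by (auto simp: axis_def)
      then have "y - axis j 1 + axis a 1 = axis i 1" using one i trade[OF ea] by blast
      moreover have "y - axis j 1 + 0 = axis i 1" using one i trade[OF zero] by blast
      ultimately have "axis a (1::real) = 0" by (metis add_left_cancel)
      then show False by (simp add: axis_eq_0_iff)
    qed
  next
    case (Suc k)
    show ?case
    proof
      assume h: "height J y = Suc (Suc (Suc k))"
      then obtain j where j: "j \<in> J" "y $ j \<ge> 1" using height_pos[of J y] by auto
      have "y - axis j 1 + 0 \<in> A" using ex Suc.prems j zero unfolding exchange_closed_def by blast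
      moreover have "height J (y - axis j 1 + 0) = Suc (Suc k)"
        using height_add_base[of J 0 j y] j h by simp
      ultimately show False using Suc.IH by blast
    qed
  qed
  show ?thesis
  proof (cases "height J x = 0")
    case True
    then show ?thesis using base_iff_height[OF ex x] by simp
  next
    case False
    then have "height J x = 1" using many[OF x] by (metis One_nat_def not0_implies_Suc)
    then show ?thesis using one[OF x] height_pos[OF False] by metis
  qed
qed

text \<open>Trading units for 0 brings a point outside the base down to height one; trading its last
  unit for all of \<open>P\<close> then places a translate of \<open>P\<close> inside the
  base.\<close>

lemma exchange_closed_card_base:
  assumes ex: "exchange_closed J P B" and P: "P \<subseteq> base J Q" "0 \<in> P" and "finite B" "B \<noteq> base J B"
  shows "card P \<le> card (base J B)"
proof -
  obtain x where "x \<in> B" "x \<notin> base J B" using assms(5) by (auto simp: base_def)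
  then have x: "x \<in> B" "height J x \<noteq> 0" using base_iff_height[OF ex] by auto
  have "\<exists>y\<in>B. height J y = 1" if "height J x = Suc k" "x \<in> B" for k x
    using that
  proof (induction k arbitrary: x)
    case (Suc k)
    then obtain j where j: "j \<in> J" "x $ j \<ge> 1" using height_pos[of J x] by auto
    have "x - axis j 1 + 0 \<in> B" using ex Suc.prems j P unfolding exchange_closed_def by blast
    moreover have "height J (x - axis j 1 + 0) = Suc k"
      using height_add_base[of J 0 j x] j Suc.prems by simp
    ultimately show ?case using Suc.IH by blast
  qed auto
  then obtain y where y: "y \<in> B" "height J y = 1" using x by (metis not0_implies_Suc)
  then obtain j where "j \<in> J" "y $ j \<ge> 1" using height_pos[of J y] by auto
  then have "(+) (y - axis j 1) ` P \<subseteq> base J B" using exchange_height_one[OF ex P(1)] y by blast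
  then have "card ((+) (y - axis j 1) ` P) \<le> card (base J B)"
    using assms by (intro card_mono) (auto simp: base_def)
  then show ?thesis by (simp add: card_image)
qed

text \<open>The translates of \<open>base J B\<close> by the vectors \<open>axis j 1\<close> are
  told apart by their \<open>J\<close>-coordinates, both from each other and from the sumset of the
  bases, where these vanish.\<close>

lemma card_sumset_thin_ge:
  assumes "finite A" "finite B" "\<And>j. j \<in> J \<Longrightarrow> axis j 1 \<in> A"
  shows "card (base J A + base J B) + card J * card (base J B) \<le> card (A + B)"
proof -
  have sub: "base J A \<subseteq> A" "base J B \<subseteq> B" by (auto simp: base_def)
  have finb: "finite (base J A)" "finite (base J B)" using assms sub finite_subset by blast+
  define U where "U = (\<Union>j\<in>J. (+) (axis j 1) ` base J B)"
  have coord: "y $ i = (if i = j then 1 else 0)"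
    if "y \<in> (+) (axis j 1) ` base J B" "i \<in> J" for y i j
    using that by (auto simp: base_def axis_def)
  have "card U = (\<Sum>j\<in>J. card ((+) (axis j 1) ` base J B))"
    unfolding U_def
  proof (rule card_UN_disjoint)
    show "\<forall>i\<in>J. \<forall>j\<in>J. i \<noteq> j \<longrightarrow>
        (+) (axis i 1) ` base J B \<inter> (+) (axis j 1) ` base J B = {}"
      using coord by (metis disjoint_iff zero_neq_one)
  qed (use finb in auto)
  then have U: "card U = card J * card (base J B)" by (simp add: card_image)
  have "(base J A + base J B) \<inter> U = {}"
  proof -
    have "y \<notin> U" if y: "y \<in> base J A + base J B" for y
    proof
      assume "y \<in> U"
      then obtain j where j: "j \<in> J" "y \<in> (+) (axis j 1) ` base J B" unfolding U_def by (rule UN_E)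
      have "y $ j = 0" using y j(1) by (auto simp: base_def elim!: set_plus_elim)
      then show False using coord[OF j(2,1)] by simp
    qed
    then show ?thesis by (simp add: disjoint_iff)
  qed
  then have "card (base J A + base J B) + card U = card ((base J A + base J B) \<union> U)"
    using finb by (simp add: card_Un_disjoint finite_set_plus U_def)
  also have "\<dots> \<le> card (A + B)"
    using assms sub by (intro card_mono finite_set_plus Un_least set_plus_mono2)
      (auto simp: U_def intro!: set_plus_intro)
  finally show ?thesis using U by simp
qed

section \<open>Normalised pairs and their reduction to a plane\<close>

text \<open>The point \<open>axis a 2\<close> secures a third column in the plane of
  \<open>a\<close> and \<open>z\<close>, besides those of 0 and \<open>axis a 1\<close>. The
  coordinates \<open>a\<close> and \<open>z\<close> may be arbitrary reals; the others must be
  natural numbers for the height to be exact.\<close>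

definition normalised :: "'n \<Rightarrow> 'n \<Rightarrow> (real ^ 'n) set \<Rightarrow> (real ^ ('n::finite)) set \<Rightarrow> bool" where
  "normalised z a A B \<longleftrightarrow> 0 \<in> A \<and> axis a 2 \<in> A \<and> (\<forall>j. j \<noteq> z \<longrightarrow> axis j 1 \<in> A) \<and>
     (\<forall>x\<in>A \<union> B. \<forall>j\<in>- {a, z}. x $ j \<in> \<nat>)"

text \<open>The required points with \<open>j\<close>-th coordinate 0 stay in place. The remaining
  one, \<open>axis j 1\<close>, shares its line with \<open>v\<close>, so positions 0 and 1 of that
  line, \<open>v\<close> and \<open>v + w = axis j 1\<close>, are both occupied afterwards.\<close>

lemma normalised_exchange:
  assumes "finite A" and norm: "normalised z a A B" and j: "j \<notin> {a, z}"
    and v: "v \<in> base (- {a, z}) A"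
  defines "w \<equiv> axis j 1 - v"
  shows "normalised z a (compress j w A) (compress j w B)"
proof -
  have vA: "v \<in> A" and v0: "\<And>i. i \<notin> {a, z} \<Longrightarrow> v $ i = 0" using v by (auto simp: base_def)
  have wj: "w $ j = 1" using v0[OF j] by (simp add: w_def)
  have wi: "w $ i = 0" if "i \<notin> {a, z}" "i \<noteq> j" for i using v0 that by (simp add: w_def axis_def)
  have keep: "x \<in> compress j w A" if "x \<in> A" "x $ j = 0" for x
    using in_compress_of_coord_zero[OF assms(1) wj that] .
  have "slide j w (axis j 1) = v" "slide j w v = v"
    using v0[OF j] by (simp_all add: slide_def w_def)
  moreover have "axis j 1 \<in> A" using norm j by (auto simp: normalised_def)
  moreover have "v \<noteq> axis j 1" using v0[OF j] by auto
  ultimately have "slide j w v + w \<in> compress j w A"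
    using slide_plus_in_compress[OF assms(1) wj vA] by metis
  then have ej: "axis j 1 \<in> compress j w A" using \<open>slide j w v = v\<close> by (simp add: w_def)
  have "axis i 1 \<in> compress j w A" if "i \<noteq> z" for i
    using ej keep[of "axis i 1"] that norm by (cases "i = j") (auto simp: normalised_def axis_def)
  moreover have "0 \<in> compress j w A" "axis a 2 \<in> compress j w A"
    using keep norm j by (auto simp: normalised_def axis_def)
  moreover have "y $ i \<in> \<nat>" if y: "y \<in> compress j w A \<union> compress j w B" and i: "i \<in> - {a, z}" for y i
  proof (cases "i = j")
    case True
    then show ?thesis using y by (auto simp: compress_def)
  next
    case False
    then have "w $ i = 0" using wi i by simp
    then obtain x where "x \<in> A \<union> B" "x $ i = y $ i" using y compress_coord[of y j w _ i] by blast
    then show ?thesis using norm i unfolding normalised_def by metis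
  qed
  ultimately show ?thesis by (simp add: normalised_def)
qed

text \<open>Among all normalised reductions one of least total height is taken. A missing trade of
  \<open>axis j 1\<close> for \<open>v\<close> would make the compression along
  \<open>axis j 1 - v\<close> lower the height strictly.\<close>

lemma exists_exchange_closed:
  fixes A B :: "(real ^ 'n) set"
  assumes "finite A" "finite B" "normalised z a A B" "a \<noteq> z"
  defines "J \<equiv> - {a, z}"
  obtains A' B' where "reduces_to z A B A' B'" "normalised z a A' B'"
    "exchange_closed J (base J A') A'" "exchange_closed J (base J A') B'"
proof -
  define Q where "Q = (\<lambda>(A', B'). reduces_to z A B A' B' \<and> normalised z a A' B')"
  define m where "m = (\<lambda>(A', B'). sum (height J) A' + sum (height J) B')"
  have "Q (A, B)" using assms by (simp add: Q_def reduces_to_refl)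
  then obtain A' B' where Q: "Q (A', B')" and least: "\<And>X Y. Q (X, Y) \<Longrightarrow> m (A', B') \<le> m (X, Y)"
    using ex_has_least_nat[of Q "(A, B)" m] by (metis surj_pair)
  have red: "reduces_to z A B A' B'" and norm: "normalised z a A' B'" using Q by (auto simp: Q_def)
  then have fin: "finite A'" "finite B'" by (auto simp: reduces_to_def)
  have nats: "x $ j \<in> \<nat>" if "x \<in> A' \<union> B'" "j \<in> J" for x j
    using norm that unfolding normalised_def J_def by blast
  have step: "x - axis j 1 + v \<in> X"
    if X: "X = A' \<or> X = B'" and x: "x \<in> X" "x $ j \<ge> 1" and j: "j \<in> J" and v: "v \<in> base J A'" for X x j v
  proof (rule ccontr)
    define w where "w = axis j 1 - v"
    assume "x - axis j 1 + v \<notin> X"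
    then have notin: "x - w \<notin> X" by (simp add: w_def algebra_simps)
    have w: "w $ j = 1" "\<And>i. i \<in> J \<Longrightarrow> i \<noteq> j \<Longrightarrow> w $ i = 0"
      using v j by (auto simp: w_def base_def axis_def)
    note nonincreasing = sum_height_compress_le(1)[OF _ w(1) j w(2)]
    have le: "sum (height J) (compress j w A') \<le> sum (height J) A'"
      "sum (height J) (compress j w B') \<le> sum (height J) B'"
      using fin nats j by (auto intro!: nonincreasing)
    have "finite X" "\<And>y. y \<in> X \<Longrightarrow> y $ j \<in> \<nat>" using X fin nats j by auto
    then have "sum (height J) (compress j w X) < sum (height J) X"
      using sum_height_compress_le(2)[OF _ w(1) j w(2) _ x notin] by blast
    \<comment> \<open>Both sets are compressed together: the one lacking a trade drops strictly, and
      the other does not rise.\<close>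
    then have "m (compress j w A', compress j w B') < m (A', B')"
      using le X by (elim disjE) (simp_all add: m_def)
    moreover have "Q (compress j w A', compress j w B')"
      unfolding Q_def w_def prod.case
      using reduces_to_compress_trans[OF red, of w j] normalised_exchange[OF fin(1) norm, of j v] w v j
      by (auto simp: J_def w_def)
    ultimately show False using least by (simp add: leD)
  qed
  show thesis
  proof (rule that[OF red norm])
    show "exchange_closed J (base J A') A'" "exchange_closed J (base J A') B'"
      using nats step unfolding exchange_closed_def by blast+
  qed
qed

lemma card_planar_base_sumset:
  fixes P Q :: "(real ^ 'n) set"
  assumes "finite P" "finite Q" and planar: "\<And>x j. x \<in> P \<union> Q \<Longrightarrow> j \<notin> {a, z} \<Longrightarrow> x $ j = 0"
    and "Q \<noteq> {}" "card Q \<le> card P" "card ((\<lambda>x. x $ a) ` P) \<ge> 3" "4 * card ((\<lambda>x. x $ a) ` P) \<le> card P"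
  shows "real (card (P + Q)) \<ge> real (card P) + 7 / 3 * real (card Q) - 16"
proof -
  define f where "f x = (x $ a, x $ z)" for x :: "real ^ 'n"
  have "inj_on f (P \<union> Q)"
  proof (rule inj_onI)
    fix x y assume "x \<in> P \<union> Q" "y \<in> P \<union> Q" "f x = f y"
    then show "x = y" using planar by (metis (no_types, opaque_lifting) f_def insertE prod.inject singletonD vec_eq_iff)
  qed
  then have inj: "card (f ` P) = card P" "card (f ` Q) = card Q"
    by (auto intro!: card_image intro: inj_on_subset)
  have cols: "fst ` f ` P = (\<lambda>x. x $ a) ` P" by (auto simp: f_def image_image)
  have add: "f (x + y) = f x + f y" for x y by (simp add: f_def)
  have "f ` (P + Q) = f ` P + f ` Q"
  proof
    show "f ` (P + Q) \<subseteq> f ` P + f ` Q" by (auto simp: add elim!: set_plus_elim intro!: set_plus_intro)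
    show "f ` P + f ` Q \<subseteq> f ` (P + Q)"
    proof
      fix t assume "t \<in> f ` P + f ` Q"
      then obtain x y where "x \<in> P" "y \<in> Q" "t = f x + f y" by (auto elim!: set_plus_elim)
      then show "t \<in> f ` (P + Q)" using add by (metis image_eqI set_plus_intro)
    qed
  qed
  then have "card (f ` P + f ` Q) \<le> card (P + Q)"
    using assms by (metis card_image_le finite_set_plus)
  moreover have "real (card (f ` P + f ` Q)) \<ge> real (card (f ` P)) + 7 / 3 * real (card (f ` Q)) - 16"
    using assms inj cols by (intro card_planar_sumset_ge_linear) auto
  ultimately show ?thesis using inj by linarith
qed

text \<open>Columns of the base are separated by coordinate \<open>a\<close>, and each
  \<open>axis j 1\<close> adds a column of its own. Thus the average number of points per column
  stays at least four when these thin columns are discarded.\<close>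

lemma column_count_thin_ge:
  fixes A :: "(real ^ 'n) set"
  assumes "finite A" "a \<noteq> z" and J: "J = - {a, z}" and "\<And>j. j \<in> J \<Longrightarrow> axis j 1 \<in> A"
  shows "card ((\<lambda>x. x $ a) ` base J A) + card J \<le> column_count z A"
proof -
  let ?\<pi> = "slide z (axis z 1) :: real ^ 'n \<Rightarrow> real ^ 'n"
  let ?E = "(\<lambda>j. axis j 1 :: real ^ 'n) ` J"
  have coord: "?\<pi> x $ j = x $ j" if "j \<noteq> z" for x :: "real ^ 'n" and j using that by (simp add: slide_nth axis_def)
  have finb: "finite (base J A)" using assms(1) by (simp add: base_def)
  have "(\<lambda>x. x $ a) ` base J A = (\<lambda>x. x $ a) ` ?\<pi> ` base J A"
    using coord assms(2) by (simp add: image_image)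
  then have 1: "card ((\<lambda>x. x $ a) ` base J A) \<le> card (?\<pi> ` base J A)"
    using finb by (metis card_image_le finite_imageI)
  have E: "card ?E = card J" by (auto intro!: card_image inj_onI simp: axis_eq_axis)
  have "?\<pi> ` base J A \<inter> ?E = {}"
  proof -
    have "?\<pi> x \<noteq> axis j 1" if "x \<in> base J A" "j \<in> J" for x j
      using that coord[of j x] J by (auto simp: base_def)
    then show ?thesis by auto
  qed
  then have "card (?\<pi> ` base J A) + card ?E = card (?\<pi> ` base J A \<union> ?E)"
    using finb by (simp add: card_Un_disjoint)
  also have "\<dots> \<le> card (?\<pi> ` A)"
  proof (rule card_mono)
    have "axis j 1 = ?\<pi> (axis j 1)" if "j \<in> J" for j
      using that J by (auto simp: slide_def axis_def)
    then have "?E \<subseteq> ?\<pi> ` A" using assms(4) by blast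
    moreover have "?\<pi> ` base J A \<subseteq> ?\<pi> ` A" by (auto simp: base_def)
    ultimately show "?\<pi> ` base J A \<union> ?E \<subseteq> ?\<pi> ` A" by blast
  qed (use assms in auto)
  finally show ?thesis using 1 E by (simp add: column_count_def)
qed

theorem card_sumset_normalised_ge:
  fixes A B :: "(real ^ 'n) set" and z a :: 'n
  assumes fin: "finite A" "finite B" and "B \<noteq> {}" "card B \<le> card A"
    and "normalised z a A B" "a \<noteq> z" "4 * column_count z A \<le> card A"
  defines "\<delta> \<equiv> real CARD('n) - 2"
  shows "real (card (A + B)) \<ge> real (card A) + (\<delta> + 7 / 3) * real (card B) - (\<delta>\<^sup>2 + 10 / 3 * \<delta> + 16)"
proof -
  define J where "J = - {a, z}"
  obtain A' B' where red: "reduces_to z A B A' B'" and norm: "normalised z a A' B'"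
    and exA: "exchange_closed J (base J A') A'" and exB: "exchange_closed J (base J A') B'"
    using exists_exchange_closed[OF fin assms(5,6)] unfolding J_def by blast
  have red': "finite A'" "finite B'" "card A' = card A" "card B' = card B"
    "card (A' + B') \<le> card (A + B)" "column_count z A' \<le> column_count z A"
    using red by (auto simp: reduces_to_def)
  have zero: "0 \<in> A'" and two: "axis a 2 \<in> A'" and ej: "\<And>j. j \<noteq> z \<Longrightarrow> axis j 1 \<in> A'"
    using norm by (auto simp: normalised_def)
  define P where "P = base J A'"
  define Q0 where "Q0 = base J B'"
  have finPQ: "finite P" "finite Q0" using red' by (simp_all add: P_def Q0_def base_def)
  have in_P: "0 \<in> P" "axis a 1 \<in> P" "axis a 2 \<in> P"
    using zero two ej[OF assms(6)] by (auto simp: P_def base_def J_def axis_def)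
  have cardJ: "real (card J) = \<delta>"
  proof -
    have "card J = CARD('n) - card {a, z}" 
      by (simp add: J_def Compl_eq_Diff_UNIV card_Diff_subset)
    moreover have "card {a, z} = 2" using assms(6) by simp
    moreover have "card {a, z} \<le> CARD('n)" by (rule card_mono) auto
    ultimately show ?thesis by (simp add: \<delta>_def)
  qed
  have "A' \<subseteq> P \<union> (\<lambda>j. axis j 1) ` J"
    using exchange_closed_self[OF exA red'(1) zero ej[OF assms(6)]] unfolding P_def J_def by blast
  then have "card A' \<le> card (P \<union> (\<lambda>j. axis j 1) ` J)" using finPQ by (intro card_mono) auto
  also have "\<dots> \<le> card P + card ((\<lambda>j. axis j (1::real)) ` J)" by (rule card_Un_le)
  also have "\<dots> \<le> card P + card J" by (simp add: card_image_le)
  finally have cardP: "card A \<le> card P + card J" using red' by simp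
  have cardQ0: "card B \<le> card Q0 + card J" and Q0: "Q0 \<noteq> {}"
  proof -
    have "card B \<le> card Q0 + card J \<and> Q0 \<noteq> {}"
    proof (cases "B' = base J B'")
      case True
      then have "Q0 = B'" by (simp add: Q0_def)
      moreover have "card B' \<noteq> 0" using red' fin assms(3) by simp
      ultimately show ?thesis using red' by auto
    next
      case False
      \<comment> \<open>If \<open>B'\<close> leaves the plane, its planar part is at least as large
        as \<open>P\<close>, so \<open>card B \<le> card A \<le> card P + card J\<close> already
        bounds what lies outside.\<close>
      then have "card P \<le> card Q0"
        using exchange_closed_card_base[OF exB subset_refl] in_P red' by (simp add: P_def Q0_def)
      moreover have "card P \<noteq> 0" using in_P finPQ by auto
      ultimately show ?thesis using cardP assms(4) by auto
    qed
    then show "card B \<le> card Q0 + card J" "Q0 \<noteq> {}" by auto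
  qed
  \<comment> \<open>The planar estimate needs a second set no larger than \<open>P\<close>.
    Truncation costs nothing essential, since
    \<open>card B \<le> card A \<le> card P + card J\<close> still gives
    \<open>card Q \<ge> card B - card J\<close>.\<close>
  obtain Q where Q: "Q \<subseteq> Q0" "card Q = min (card Q0) (card P)"
    by (meson min.cobounded1 obtain_subset_with_card_n)
  have "card Q0 \<noteq> 0" "card P \<noteq> 0" using Q0 in_P finPQ by auto
  then have "card Q \<noteq> 0" using Q by linarith
  then have Qne: "Q \<noteq> {}" by auto
  have finQ: "finite Q" using Q finPQ finite_subset by blast
  have cols: "card ((\<lambda>x. x $ a) ` P) + card J \<le> column_count z A'"
    unfolding P_def using column_count_thin_ge[OF red'(1) assms(6) J_def] ej by (auto simp: J_def)
  have "card {0, 1, 2 :: real} \<le> card ((\<lambda>x. x $ a) ` P)"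
    using finPQ imageI[OF in_P(1), of "\<lambda>x. x $ a"] imageI[OF in_P(2), of "\<lambda>x. x $ a"] imageI[OF in_P(3), of "\<lambda>x. x $ a"]
    by (intro card_mono) (auto simp: axis_def)
  then have three: "card ((\<lambda>x. x $ a) ` P) \<ge> 3" by simp
  \<comment> \<open>From
    \<open>4 * (columns + card J) \<le> card A \<le> card P + card J\<close>.\<close>
  have "4 * card ((\<lambda>x. x $ a) ` P) \<le> card P" using cols red' assms(7) cardP by linarith
  then have PQ: "real (card (P + Q)) \<ge> real (card P) + 7 / 3 * real (card Q) - 16"
    using finPQ finQ Qne Q three
    by (intro card_planar_base_sumset[where a = a and z = z]) (auto simp: P_def Q0_def base_def J_def)
  have "card (P + Q) \<le> card (P + Q0)"
    using finPQ Q by (intro card_mono finite_set_plus set_plus_mono2) auto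
  moreover have "card (P + Q0) + card J * card Q0 \<le> card (A' + B')"
    unfolding P_def Q0_def using red' ej by (intro card_sumset_thin_ge) (auto simp: J_def)
  ultimately have "card (P + Q) + card J * card Q0 \<le> card (A + B)" using red' by linarith
  then have main: "real (card (A + B)) \<ge> real (card (P + Q)) + \<delta> * real (card Q0)"
    using cardJ by (metis of_nat_add of_nat_le_iff of_nat_mult)
  have \<delta>: "\<delta> \<ge> 0" using cardJ by (metis of_nat_0_le_iff)
  \<comment> \<open>The error term collects a loss of \<open>\<delta>\<close> from \<open>P\<close>,
    \<open>7/3 * \<delta>\<close> from \<open>Q\<close>, \<open>\<delta> * \<delta>\<close> from the
    translates of \<open>Q0\<close>, and 16 from the planar bound.\<close>
  have reals: "real (card P) \<ge> real (card A) - \<delta>" "real (card Q0) \<ge> real (card B) - \<delta>"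
    "real (card Q) \<ge> real (card B) - \<delta>"
    using cardP cardQ0 Q assms(4) by (auto simp flip: cardJ)
  have "\<delta> * real (card Q0) \<ge> \<delta> * (real (card B) - \<delta>)" using reals \<delta> by (intro mult_left_mono) auto
  then show ?thesis using main PQ reals by (simp add: algebra_simps power2_eq_square)
qed

subsection \<open>Normalisation\<close>

text \<open>Compressing along \<open>axis z 1\<close> first puts one point of every column into the
  slice of vanishing \<open>z\<close>-th coordinate. The later axes, taken one at a time in the
  induction on \<open>K\<close>, preserve the size of this slice and the closure under steps down
  along axes already treated.\<close>

lemma compress_axes:
  fixes A B :: "(real ^ 'n) set"
  assumes fin: "finite A" "finite B" and "0 \<in> A" and ej: "\<And>j. j \<noteq> z \<Longrightarrow> \<exists>t. axis j 1 + axis z t \<in> A"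
    and "z \<notin> K"
  shows "\<exists>A' B'. reduces_to z A B A' B' \<and> 0 \<in> A' \<and> (\<forall>j. j \<noteq> z \<longrightarrow> axis j 1 \<in> A') \<and>
    (\<forall>x\<in>A' \<union> B'. \<forall>k\<in>K. x $ k \<in> \<nat>) \<and> (\<forall>x\<in>A'. \<forall>k\<in>K. x $ k \<ge> 1 \<longrightarrow> x - axis k 1 \<in> A') \<and>
    column_count z A \<le> card {x \<in> A'. x $ z = 0}"
proof -
  have "finite K" by simp
  then show ?thesis using \<open>z \<notin> K\<close>
  proof (induction K rule: finite_induct)
    case empty
    let ?e = "axis z 1 :: real ^ 'n"
    let ?A = "compress z ?e A"
    have ez: "?e $ z = 1" by (simp add: axis_def)
    have slide: "slide z ?e x \<in> ?A" if "x \<in> A" for x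
      using slide_in_compress[OF fin(1) ez that] .
    have "0 \<in> ?A" using slide[OF \<open>0 \<in> A\<close>] by simp
    moreover have "axis j 1 \<in> ?A" if j: "j \<noteq> z" for j
    proof -
      obtain t where "axis j 1 + axis z t \<in> A" using ej[OF j] by blast
      moreover have "slide z ?e (axis j 1 + axis z t) = axis j 1"
        using j by (simp add: vec_eq_iff slide_nth axis_def)
      ultimately show ?thesis using slide by metis
    qed
    moreover have "column_count z A \<le> card {x \<in> ?A. x $ z = 0}"
      unfolding column_count_def using slide finite_compress[OF fin(1) ez] ez
      by (intro card_mono) (auto simp: slide_nth)
    moreover have "reduces_to z A B ?A (compress z ?e B)"
      using fin ez by (intro reduces_to_compress) auto
    ultimately show ?case by blast
  next
    case (insert i K)
    then obtain A' B' where red: "reduces_to z A B A' B'" and zero: "0 \<in> A'"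
      and e: "\<And>j. j \<noteq> z \<Longrightarrow> axis j 1 \<in> A'"
      and nats: "\<And>x k. x \<in> A' \<union> B' \<Longrightarrow> k \<in> K \<Longrightarrow> x $ k \<in> \<nat>"
      and down: "\<And>x k. x \<in> A' \<Longrightarrow> k \<in> K \<Longrightarrow> x $ k \<ge> 1 \<Longrightarrow> x - axis k 1 \<in> A'"
      and floor: "column_count z A \<le> card {x \<in> A'. x $ z = 0}" by auto
    let ?e = "axis i 1 :: real ^ 'n"
    let ?A = "compress i ?e A'" and ?B = "compress i ?e B'"
    have fin': "finite A'" using red by (simp add: reduces_to_def)
    have ei: "?e $ i = 1" by (simp add: axis_def)
    have iz: "i \<noteq> z" "z \<noteq> i" using insert.prems by auto
    have other: "?e $ j = 0" if "j \<noteq> i" for j using that by (simp add: axis_def)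
    have "reduces_to z A B ?A ?B" using reduces_to_compress_trans[OF red ei] iz by blast
    moreover have zero': "0 \<in> ?A" using in_compress_of_coord_zero[OF fin' ei zero] by simp
    moreover have "axis j 1 \<in> ?A" if j: "j \<noteq> z" for j
    proof (cases "j = i")
      case True
      have "0 \<noteq> ?e" using ei by auto
      moreover have "slide i ?e 0 = slide i ?e ?e" by (simp add: slide_self ei)
      ultimately have "slide i ?e 0 + ?e \<in> ?A"
        using slide_plus_in_compress[OF fin' ei zero e[OF iz(1)]] by blast
      then show ?thesis using True by simp
    next
      case False
      then show ?thesis using in_compress_of_coord_zero[OF fin' ei e[OF j]] by (simp add: axis_def)
    qed
    moreover have "y $ k \<in> \<nat>" if y: "y \<in> ?A \<union> ?B" and k: "k \<in> insert i K" for y k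
    proof (cases "k = i")
      case True
      then show ?thesis using y by (auto simp: compress_def)
    next
      case False
      then obtain x where "x \<in> A' \<union> B'" "x $ k = y $ k"
        using y compress_coord[of y i ?e _ k] other[OF False] by blast
      then show ?thesis using nats k False by (metis insertE)
    qed
    moreover have "y - axis k 1 \<in> ?A" if y: "y \<in> ?A" "y $ k \<ge> 1" and k: "k \<in> insert i K" for y k
    proof (cases "k = i")
      case True
      then obtain m where m: "y $ i = real m" using y by (auto simp: compress_def elim: Nats_cases)
      have "1 \<le> m" using m y(2) True by simp
      then have c: "(y - ?e) $ i = real (m - 1)" using m by (simp add: axis_def of_nat_diff)
      have s: "slide i ?e (y - ?e) = slide i ?e y" by (simp add: slide_diff slide_self ei)
      have "m < card {x \<in> A'. slide i ?e x = slide i ?e y}" using y(1) m unfolding compress_def by simp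
      then show ?thesis unfolding True compress_def mem_Collect_eq s c by simp
    next
      case False
      then have k: "k \<in> K" using k by simp
      let ?d = "axis k 1 :: real ^ 'n"
      have di: "?d $ i = 0" using False by (simp add: axis_def)
      have sd: "slide i ?e ?d = ?d" using di by (simp add: slide_def)
      \<comment> \<open>Subtracting \<open>axis k 1\<close> injects the line through
        \<open>y\<close> into the line through \<open>y - axis k 1\<close>, so the latter has at
        least as many points and position \<open>y $ i\<close> is occupied there too.\<close>
      have "(\<lambda>x. x - ?d) ` {x \<in> A'. slide i ?e x = slide i ?e y}
        \<subseteq> {x \<in> A'. slide i ?e x = slide i ?e (y - ?d)}"
      proof
        fix t assume "t \<in> (\<lambda>x. x - ?d) ` {x \<in> A'. slide i ?e x = slide i ?e y}"
        then obtain x where x: "x \<in> A'" "slide i ?e x = slide i ?e y" "t = x - ?d" by auto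
        have "x $ k = y $ k" using arg_cong[OF x(2), of "\<lambda>x. x $ k"] False by (simp add: slide_nth axis_def)
        then have "x - ?d \<in> A'" using down[OF x(1) k] y by simp
        then show "t \<in> {x \<in> A'. slide i ?e x = slide i ?e (y - ?d)}"
          using x by (simp add: slide_diff)
      qed
      then have "card ((\<lambda>x. x - ?d) ` {x \<in> A'. slide i ?e x = slide i ?e y})
        \<le> card {x \<in> A'. slide i ?e x = slide i ?e (y - ?d)}"
        by (rule card_mono[rotated]) (simp add: fin')
      moreover have "inj_on (\<lambda>x. x - ?d) {x \<in> A'. slide i ?e x = slide i ?e y}" by (simp add: inj_on_def)
      ultimately have "card {x \<in> A'. slide i ?e x = slide i ?e y} \<le> card {x \<in> A'. slide i ?e x = slide i ?e (y - ?d)}"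
        by (simp add: card_image)
      then show ?thesis using y di by (auto simp: compress_def)
    qed
    moreover have "column_count z A \<le> card {x \<in> ?A. x $ z = 0}"
    proof -
      have "slide i ?e x $ z = x $ z" for x using iz by (simp add: slide_nth axis_def)
      then show ?thesis using card_Collect_compress[OF fin' ei, of "\<lambda>p. p $ z = 0"] floor by simp
    qed
    ultimately show ?case by blast
  qed
qed

text \<open>The slice of vanishing \<open>z\<close>-th coordinate has more than
  \<open>CARD('n)\<close> points, hence one besides 0 and the unit vectors. Closure downwards then
  yields some \<open>axis i 1 + axis k 1\<close>. If \<open>i = k\<close> this is
  \<open>axis i 2\<close>; otherwise compression along \<open>axis k 1 - axis i 1\<close> slides it
  to \<open>axis i 2\<close>.\<close>

lemma exists_normalised:
  fixes A B :: "(real ^ 'n) set"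
  assumes fin: "finite A" "finite B" and "0 \<in> A" and "\<And>j. j \<noteq> z \<Longrightarrow> \<exists>t. axis j 1 + axis z t \<in> A"
    and many: "column_count z A > CARD('n)"
  obtains A' B' a where "reduces_to z A B A' B'" "normalised z a A' B'" "a \<noteq> z"
proof -
  define K where "K = - {z}"
  have "z \<notin> K" by (simp add: K_def)
  from compress_axes[OF assms(1-4) this] obtain A' B'
    where red: "reduces_to z A B A' B'" and zero: "0 \<in> A'"
      and e: "\<And>j. j \<noteq> z \<Longrightarrow> axis j 1 \<in> A'"
      and nats: "\<And>x k. x \<in> A' \<union> B' \<Longrightarrow> k \<in> K \<Longrightarrow> x $ k \<in> \<nat>"
      and down: "\<And>x k. x \<in> A' \<Longrightarrow> k \<in> K \<Longrightarrow> x $ k \<ge> 1 \<Longrightarrow> x - axis k 1 \<in> A'"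
      and floor: "column_count z A \<le> card {x \<in> A'. x $ z = 0}" by auto
  have fin': "finite A'" using red by (simp add: reduces_to_def)
  let ?S = "insert 0 ((\<lambda>j. axis j (1::real)) ` K)"
  have "card ?S \<le> Suc (card ((\<lambda>j. axis j (1::real)) ` K))" by (simp add: card_insert_if)
  also have "\<dots> \<le> Suc (card K)" by (simp add: card_image_le)
  also have "\<dots> = CARD('n)" by (simp add: K_def Compl_eq_Diff_UNIV card_Diff_subset)
  finally have "card ?S < card {x \<in> A'. x $ z = 0}" using many floor by linarith
  then have "\<not> {x \<in> A'. x $ z = 0} \<subseteq> ?S" by (meson card_mono finite finite_imageI finite_insert leD)
  then obtain x where x: "x \<in> A'" "x $ z = 0" "x \<notin> ?S" by auto
  have vec_eqI: "u = v" if "u $ z = v $ z" "\<And>k. k \<in> K \<Longrightarrow> u $ k = v $ k" for u v :: "real ^ 'n"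
  proof -
    have "u $ k = v $ k" for k using that by (cases "k = z") (auto simp: K_def)
    then show ?thesis by (simp add: vec_eq_iff)
  qed
  have descend: "\<exists>k\<in>K. y $ k \<ge> 1" if y: "y \<in> A'" "y $ z = 0" "y \<noteq> 0" for y
  proof (rule ccontr)
    assume neg: "\<not> ?thesis"
    have "y $ k = 0" if k: "k \<in> K" for k
    proof -
      obtain m where "y $ k = real m" using nats[of y k] y k by (auto elim: Nats_cases)
      moreover have "\<not> y $ k \<ge> 1" using neg k by blast
      ultimately show ?thesis by simp
    qed
    then have "y = 0" using y(2) by (intro vec_eqI) auto
    then show False using y(3) by simp
  qed
  \<comment> \<open>Unit steps down from \<open>x\<close> reach every natural point below it; the
    induction counts the steps.\<close>
  have mem_of_le: "y \<in> A'"
    if "x \<in> A'" "x $ z = 0" "y $ z = 0" "\<And>k. k \<in> K \<Longrightarrow> y $ k \<in> \<nat> \<and> y $ k \<le> x $ k" for x y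
    using that
  proof (induction "height K (x - y)" arbitrary: x)
    case 0
    have "(x - y) $ k \<in> \<nat>" if k: "k \<in> K" for k
    proof -
      obtain p q where "x $ k = real p" "y $ k = real q"
        using nats[of x k] 0 k by (metis Nats_cases UnI1)
      moreover from this have "q \<le> p" using "0.prems"(4)[OF k] by simp
      ultimately have "(x - y) $ k = real (p - q)" by (simp add: of_nat_diff)
      then show ?thesis by simp
    qed
    then have "\<forall>k\<in>K. (x - y) $ k = 0" using height_eq_0_iff[of K "x - y"] "0.hyps" by simp
    then have "x = y" using 0 by (intro vec_eqI) auto
    then show ?case using 0 by simp
  next
    case (Suc h)
    then obtain j where j: "j \<in> K" "(x - y) $ j \<ge> 1" using height_pos[of K "x - y"] by auto
    have yj: "y $ j \<ge> 0" using Suc.prems(4)[OF j(1)] by (auto elim: Nats_cases)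
    show ?case
    proof (rule Suc.hyps(1))
      have "height K (x - y) = Suc (height K (x - y - axis j 1 + 0))"
        using j by (intro height_add_base) auto
      then show "h = height K (x - axis j 1 - y)"
        using Suc.hyps(2) by (simp add: algebra_simps)
      show "x - axis j 1 \<in> A'" using down[OF Suc.prems(1) j(1)] j(2) yj by simp
      show "(x - axis j 1) $ z = 0" using Suc.prems j by (auto simp: axis_def K_def)
      show "y $ k \<in> \<nat> \<and> y $ k \<le> (x - axis j 1) $ k" if "k \<in> K" for k
        using Suc.prems(4)[OF that] j by (auto simp: axis_def)
    qed (use Suc.prems in auto)
  qed
  have "x \<noteq> 0" using x(3) by auto
  then obtain i where i: "i \<in> K" "x $ i \<ge> 1" using descend[OF x(1,2)] by blast
  then have iz: "i \<noteq> z" by (simp add: K_def)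
  \<comment> \<open>Since \<open>x\<close> is not a unit vector, a nonzero point remains after the
    first step down, so a second step exists.\<close>
  have "x - axis i 1 \<in> A'" using down[OF x(1) i] .
  moreover have "(x - axis i 1) $ z = 0" using x iz by (simp add: axis_def)
  moreover have "x - axis i 1 \<noteq> 0" using x(3) i(1) by auto
  ultimately obtain k where k: "k \<in> K" "(x - axis i 1) $ k \<ge> 1" using descend by blast
  then have kz: "k \<noteq> z" by (simp add: K_def)
  have nonneg: "x $ j \<ge> 0" if "j \<in> K" for j using nats[of x j] x that by (auto elim: Nats_cases)
  have ik: "axis i 1 + axis k 1 \<in> A'"
  proof (rule mem_of_le[OF x(1,2)])
    show "(axis i 1 + axis k 1 :: real ^ 'n) $ z = 0" using iz kz by (simp add: axis_def)
    show "(axis i 1 + axis k 1 :: real ^ 'n) $ j \<in> \<nat> \<and> (axis i 1 + axis k 1) $ j \<le> x $ j" if "j \<in> K" for j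
      using i k nonneg[OF that] by (auto simp: axis_def split: if_splits)
  qed
  show thesis
  proof (cases "i = k")
    case True
    then have "axis i 1 + axis k 1 = (axis i 2 :: real ^ 'n)" by (simp add: vec_eq_iff axis_def)
    then have "normalised z i A' B'" using zero e nats ik by (auto simp: normalised_def K_def)
    then show thesis using that red iz by blast
  next
    case False
    define w where "w = axis k 1 - (axis i 1 :: real ^ 'n)"
    have wk: "w $ k = 1" using False by (simp add: w_def axis_def)
    have keep: "y \<in> compress k w A'" if "y \<in> A'" "y $ k = 0" for y
      using in_compress_of_coord_zero[OF fin' wk that] .
    have sl: "slide k w (axis i 1) = axis i 1" "slide k w (axis k 1) = axis i 1"
      "slide k w (axis i 1 + axis k 1) = axis i 2"
      using False by (auto simp: vec_eq_iff slide_nth w_def axis_def)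
    have "axis i 1 \<noteq> (axis k 1 :: real ^ 'n)" using False by (simp add: axis_eq_axis)
    then have "slide k w (axis i 1) + w \<in> compress k w A'"
      using sl by (intro slide_plus_in_compress[OF fin' wk e[OF iz] e[OF kz]]) auto
    then have "axis k 1 \<in> compress k w A'" using sl by (simp add: w_def)
    then have axes: "axis j 1 \<in> compress k w A'" if "j \<noteq> z" for j
      using keep[OF e[OF that]] by (cases "j = k") (auto simp: axis_def)
    have "axis i 2 \<in> compress k w A'" using slide_in_compress[OF fin' wk ik] sl by simp
    moreover have "y $ j \<in> \<nat>" if y: "y \<in> compress k w A' \<union> compress k w B'" and j: "j \<in> - {i, z}" for y j
    proof (cases "j = k")
      case True
      then show ?thesis using y by (auto simp: compress_def)
    next
      case False
      then have "w $ j = 0" using j by (simp add: w_def axis_def)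
      then obtain t where "t \<in> A' \<union> B'" "t $ j = y $ j" using y compress_coord[of y k w _ j] by blast
      then show ?thesis using nats[of t j] j by (simp add: K_def)
    qed
    ultimately have "normalised z i (compress k w A') (compress k w B')"
      using axes keep[OF zero] by (simp add: normalised_def)
    moreover have "reduces_to z A B (compress k w A') (compress k w B')"
      using reduces_to_compress_trans[OF red wk] kz by blast
    ultimately show thesis using that iz by blast
  qed
qed

subsection \<open>Coordinates adapted to a line\<close>

text \<open>Each line of the family is the coset of \<open>span {u}\<close> through any of its
  points in \<open>A\<close>. Written as an image of \<open>A\<close>, the family can be compared
  with a column count.\<close>

lemma lines_meeting_eq:
  fixes A l :: "'a::euclidean_space set"
  assumes "is_line l"
  obtains u where "u \<noteq> 0" "lines_meeting l A = (\<lambda>x. (+) x ` span {u}) ` A"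
proof -
  have l: "affine l" "aff_dim l = 1" using assms by (auto simp: is_line_def)
  then have "l \<noteq> {}" by auto
  then obtain S where S: "subspace S" "affine_parallel l S"
    using affine_parallel_subspace[OF l(1)] by blast
  then have "dim S = 1" using aff_dim_affine[OF l(1) S] \<open>l \<noteq> {}\<close> l(2) by simp
  then obtain C where C: "C \<subseteq> S" "independent C" "S \<subseteq> span C" "card C = 1"
    using basis_exists[of S] by metis
  then obtain u where u: "C = {u}" by (auto simp: card_1_singleton_iff)
  have "u \<noteq> 0" using C(2) u by auto
  have Su: "S = span {u}" using C u S(1) by (metis span_subspace)
  obtain c where c: "l = (+) c ` S"
    using affine_parallel_commute[of l S] S(2) by (auto simp: affine_parallel_def)
  have shift: "(+) (x + s) ` S = (+) x ` S" if "s \<in> S" for x s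
  proof (intro equalityI subsetI)
    fix y assume "y \<in> (+) (x + s) ` S"
    then obtain t where "t \<in> S" "y = x + (s + t)" by (auto simp: add.assoc)
    then show "y \<in> (+) x ` S" using that subspace_add[OF S(1)] by blast
  next
    fix y assume "y \<in> (+) x ` S"
    then obtain t where "t \<in> S" "y = x + s + (t - s)" by auto
    then show "y \<in> (+) (x + s) ` S" using that subspace_diff[OF S(1)] by blast
  qed
  have "lines_meeting l A = (\<lambda>x. (+) x ` S) ` A"
  proof (intro equalityI subsetI)
    fix m assume "m \<in> lines_meeting l A"
    then obtain y a where "m = (+) a ` l" "y \<in> m" "y \<in> A"
      by (auto simp: lines_meeting_def affine_parallel_def)
    moreover from this obtain s where "s \<in> S" "y = (a + c) + s" using c by (auto simp: add.assoc)
    moreover have "(+) a ` l = (+) (a + c) ` S" unfolding c by (auto simp: image_image add.assoc)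
    ultimately have "m = (+) y ` S" using shift by simp
    then show "m \<in> (\<lambda>x. (+) x ` S) ` A" using \<open>y \<in> A\<close> by blast
  next
    fix m assume "m \<in> (\<lambda>x. (+) x ` S) ` A"
    then obtain x where x: "x \<in> A" "m = (+) x ` S" by blast
    have "(+) (x - c) ` l = m" unfolding c x(2) by (auto simp: image_image)
    moreover from this have "is_line m"
      using l affine_translation[of l "x - c"] aff_dim_translation_eq[of "x - c" l]
      by (auto simp: is_line_def)
    moreover have "x \<in> m" using x subspace_0[OF S(1)] by force
    ultimately show "m \<in> lines_meeting l A"
      unfolding lines_meeting_def affine_parallel_def using x(1) by blast
  qed
  then show thesis using that \<open>u \<noteq> 0\<close> Su by simp
qed

lemma translate_span_eq_iff: "(+) x ` span {u} = (+) y ` span {u} \<longleftrightarrow> x - y \<in> span {u}"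
  for u :: "'a::real_vector"
proof
  assume "(+) x ` span {u} = (+) y ` span {u}"
  then have "x + 0 \<in> (+) y ` span {u}" using span_zero by blast
  then obtain s where "s \<in> span {u}" "x = y + s" by auto
  then show "x - y \<in> span {u}" by simp
next
  assume d: "x - y \<in> span {u}"
  show "(+) x ` span {u} = (+) y ` span {u}"
  proof (intro equalityI subsetI)
    fix t assume "t \<in> (+) x ` span {u}"
    then obtain s where "s \<in> span {u}" "t = y + ((x - y) + s)" by auto
    then show "t \<in> (+) y ` span {u}" using span_add[OF d] by blast
  next
    fix t assume "t \<in> (+) y ` span {u}"
    then obtain s where "s \<in> span {u}" "t = x + (s - (x - y))" by auto
    then show "t \<in> (+) x ` span {u}" using span_diff[OF _ d] by blast
  qed
qed

lemma card_image_eq_of_kernel: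
  assumes "finite A" and "\<And>x y. x \<in> A \<Longrightarrow> y \<in> A \<Longrightarrow> f x = f y \<longleftrightarrow> g x = g y"
  shows "card (f ` A) = card (g ` A)"
proof -
  let ?h = "\<lambda>p. g (inv_into A f p)"
  have h: "?h (f x) = g x" if "x \<in> A" for x
    using assms(2)[OF inv_into_into[OF imageI[OF that]] that] f_inv_into_f[OF imageI[OF that], of f] by metis
  have "inj_on ?h (f ` A)" using h assms(2) by (auto intro!: inj_onI)
  moreover have "?h ` f ` A = g ` A" using h by (force simp: image_image)
  ultimately show ?thesis by (metis card_image)
qed

text \<open>As \<open>A\<close> spans affinely, the differences \<open>x - p\<close> span linearly,
  so \<open>u\<close> extends to a basis by such differences; \<open>T\<close> takes this basis to
  the standard one.\<close>

lemma exists_coordinates: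
  fixes A :: "(real ^ 'n) set" and u :: "real ^ 'n" and z :: 'n
  assumes "u \<noteq> 0" "p \<in> A" "affine hull A = UNIV"
  obtains T :: "real ^ 'n \<Rightarrow> real ^ 'n" where "linear T" "inj T" "T u = axis z 1"
    "\<And>j. j \<noteq> z \<Longrightarrow> \<exists>x\<in>A. T (x - p) = axis j 1"
proof -
  let ?D = "(\<lambda>x. - p + x) ` A"
  have hull: "(\<lambda>x. p + x) ` span ?D = UNIV"
    using affine_hull_span_gen[OF hull_inc[OF assms(2)]] assms(3) by simp
  have "y \<in> span ?D" for y
  proof -
    have "p + y \<in> (\<lambda>x. p + x) ` span ?D" unfolding hull by simp
    then show ?thesis by auto
  qed
  then have "span ?D = UNIV" by blast
  moreover obtain C where C: "{u} \<subseteq> C" "C \<subseteq> insert u ?D" "independent C" "insert u ?D \<subseteq> span C"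
    using maximal_independent_subset_extend[of "{u}" "insert u ?D"] assms(1) by auto
  ultimately have span: "span C = UNIV" by (metis insert_subset span_mono span_span top.extremum_uniqueI)
  have finC: "finite C" using C(3) by (rule independent_imp_finite)
  have cardC: "card C = CARD('n)" using C(3) span by (metis dim_UNIV dim_eq_card_independent dim_span DIM_cart DIM_real mult_1_right)
  have "card (UNIV - {z}) = card (C - {u})"
    using C(1) finC cardC by (simp add: card_Diff_singleton)
  then obtain h0 where h0: "bij_betw h0 (UNIV - {z}) (C - {u})"
    using finite_same_card_bij finC by (metis finite finite_Diff)
  \<comment> \<open>The basis is indexed by coordinates with \<open>u\<close> at the prescribed
    place \<open>z\<close>.\<close>
  define h where "h = h0(z := u)"
  have hC: "h ` UNIV = C"
  proof -
    have "h ` UNIV = insert (h z) (h ` (UNIV - {z}))" by auto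
    also have "h ` (UNIV - {z}) = h0 ` (UNIV - {z})" by (intro image_cong) (auto simp: h_def)
    also have "\<dots> = C - {u}" using h0 by (simp add: bij_betw_def)
    finally show ?thesis using C(1) by (auto simp: h_def)
  qed
  define L where "L x = (\<Sum>i\<in>UNIV. x $ i *\<^sub>R h i)" for x :: "real ^ 'n"
  have lin: "linear L"
    unfolding L_def by (intro linearI) (simp_all add: scaleR_add_left sum.distrib scaleR_sum_right)
  have Laxis: "L (axis j 1) = h j" for j
  proof -
    have "L (axis j 1) = (\<Sum>i\<in>UNIV. if i = j then h i else 0)"
      unfolding L_def by (intro sum.cong) (auto simp: axis_def)
    then show ?thesis by simp
  qed
  have "C \<subseteq> range L" using hC Laxis by (metis image_subsetI rangeI)
  moreover have "subspace (range L)" using lin by (intro linear_subspace_image) auto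
  ultimately have "surj L" using span span_minimal by (metis top.extremum_uniqueI)
  then obtain T where T: "linear T" "\<And>x. T (L x) = x" "\<And>x. L (T x) = x"
    using linear_surjective_isomorphism[OF lin] by blast
  have "T (h j) = axis j 1" for j using T(2) Laxis by metis
  moreover have "h j \<in> ?D" if "j \<noteq> z" for j
  proof -
    have "h j \<in> C - {u}" using that h0 by (auto simp: h_def bij_betw_def)
    then show ?thesis using C(2) by blast
  qed
  ultimately have "\<exists>x\<in>A. T (x - p) = axis j 1" if "j \<noteq> z" for j
    using that by (metis (no_types, lifting) imageE uminus_add_conv_diff)
  moreover have "inj T" using T(3) by (metis injI)
  moreover have "T u = axis z 1" using \<open>\<And>j. T (h j) = axis j 1\<close>[of z] by (simp add: h_def)
  ultimately show thesis using that T(1) by blast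
qed

text \<open>The origin and the unit vectors other than \<open>axis z 1\<close> are their own
  projections, hence lie in different columns.\<close>

lemma CARD_le_column_count:
  fixes A :: "(real ^ 'n) set"
  assumes "finite A" "0 \<in> A" "\<And>j. j \<noteq> z \<Longrightarrow> axis j 1 \<in> A"
  shows "CARD('n) \<le> column_count z A"
proof -
  let ?S = "insert 0 ((\<lambda>j. axis j 1) ` (- {z})) :: (real ^ 'n) set"
  have "axis j (1::real) \<noteq> 0" for j :: 'n by (simp add: axis_eq_0_iff)
  then have "(0::real ^ 'n) \<notin> (\<lambda>j. axis j 1) ` (- {z})" by (metis imageE)
  moreover have "card ((\<lambda>j. axis j 1 :: real ^ 'n) ` (- {z})) = card (- {z})"
    by (intro card_image inj_onI) (simp add: axis_eq_axis)
  ultimately have "card ?S = CARD('n)"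
    by (simp add: Compl_eq_Diff_UNIV card_Diff_singleton)
  moreover have "?S \<subseteq> slide z (axis z 1) ` A"
  proof
    fix s assume "s \<in> ?S"
    then have "s \<in> A" "s $ z = 0" using assms(2,3) by (auto simp: axis_def split: if_splits)
    then show "s \<in> slide z (axis z 1) ` A" by (metis diff_zero image_eqI scaleR_zero_left slide_def)
  qed
  ultimately show ?thesis
    unfolding column_count_def using assms(1) by (metis card_mono finite_imageI)
qed

text \<open>Two images share a column exactly when \<open>x - y\<close> is a multiple of
  \<open>u\<close>, that is, when \<open>x\<close> and \<open>y\<close> lie on a common line in
  direction \<open>u\<close>.\<close>

lemma column_count_linear_image:
  fixes T :: "real ^ 'n \<Rightarrow> real ^ 'n"
  assumes "linear T" "inj T" "T u = axis z 1" "finite A"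
  shows "column_count z ((\<lambda>x. T (x - p)) ` A) = card ((\<lambda>x. (+) x ` span {u}) ` A)"
proof -
  have "slide z (axis z 1) (T (x - p)) = slide z (axis z 1) (T (y - p)) \<longleftrightarrow> x - y \<in> span {u}" for x y
  proof -
    have "slide z (axis z 1) (T (x - p)) = slide z (axis z 1) (T (y - p)) \<longleftrightarrow> slide z (axis z 1) (T (x - y)) = 0"
      using linear_diff[OF assms(1), of "x - p" "y - p"] by (simp add: slide_diff)
    also have "\<dots> \<longleftrightarrow> (\<exists>c. T (x - y) = c *\<^sub>R axis z 1)"
      by (auto simp: slide_scaleR slide_self axis_def) (auto simp: slide_def axis_def)
    also have "\<dots> \<longleftrightarrow> (\<exists>c. x - y = c *\<^sub>R u)"
      using assms by (metis injD linear_scale)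
    also have "\<dots> \<longleftrightarrow> x - y \<in> span {u}" by (auto simp: span_singleton)
    finally show ?thesis .
  qed
  then show ?thesis
    unfolding column_count_def image_image
    using assms(4) by (intro card_image_eq_of_kernel) (simp_all add: translate_span_eq_iff)
qed

theorem theorem2p7:
  fixes A B l :: "(real ^ 'n) set" and d r :: nat
  assumes "d = CARD('n)" and "d \<ge> 2"
    and "finite A" and "A \<noteq> {}" and "finite B" and "B \<noteq> {}"
    and "is_line l"
    and "r = card (lines_meeting l A)"
    and "aff_dim A = int d"
    and "card A \<ge> card B"
    and "real (card (A + B)) < real (card A) + (real d + 1 / 3) * real (card B)
           - 2 ^ (d + 1) * sqrt (real (card A)) - real (E_const d)"
  shows "r = d \<or> real r > real (card A) / 4"
proof (rule ccontr)
  assume neg: "\<not> ?thesis"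
  obtain u where u: "u \<noteq> 0" "lines_meeting l A = (\<lambda>x. (+) x ` span {u}) ` A"
    using lines_meeting_eq[OF assms(7)] by metis
  obtain p where p: "p \<in> A" using assms(4) by blast
  have "affine hull A = UNIV" using assms(1,9) aff_dim_eq_full[of A] by simp
  then obtain T :: "real ^ 'n \<Rightarrow> real ^ 'n" and z where T: "linear T" "inj T" "T u = axis z 1"
    and axes: "\<And>j. j \<noteq> z \<Longrightarrow> \<exists>x\<in>A. T (x - p) = axis j 1"
    using exists_coordinates[OF u(1) p] by metis
  \<comment> \<open>Only \<open>A\<close> is shifted: this moves \<open>p\<close> to 0 and merely
    translates the sumset.\<close>
  let ?A = "(\<lambda>x. T (x - p)) ` A" and ?B = "T ` B"
  have fin: "finite ?A" "finite ?B" using assms by auto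
  have "inj_on (\<lambda>x. T (x - p)) A" by (simp add: inj_on_def inj_eq[OF T(2)])
  then have card: "card ?A = card A" "card ?B = card B"
    using T(2) card_image[of "\<lambda>x. T (x - p)" A] card_image[of T B] inj_on_subset[OF T(2) subset_UNIV] by auto
  have "?A + ?B \<subseteq> (\<lambda>x. T (x - p)) ` (A + B)"
  proof
    fix t assume "t \<in> ?A + ?B"
    then obtain x y where xy: "x \<in> A" "y \<in> B" "t = T (x - p) + T y" by (auto elim!: set_plus_elim)
    then have "t = T ((x + y) - p)" using T(1) by (simp add: linear_add linear_diff)
    then show "t \<in> (\<lambda>x. T (x - p)) ` (A + B)" using xy by (blast intro: set_plus_intro)
  qed
  then have sum: "card (?A + ?B) \<le> card (A + B)"
    using assms by (meson card_image_le card_mono finite_imageI finite_set_plus le_trans)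
  have "T (p - p) = 0" using T(1) by (simp add: linear_0)
  then have zero: "0 \<in> ?A" using p by (metis image_eqI)
  have axes': "axis j 1 \<in> ?A" if "j \<noteq> z" for j using axes[OF that] by (metis image_eqI)
  have r: "column_count z ?A = r"
    using column_count_linear_image[OF T assms(3)] assms(8) u(2) by simp
  \<comment> \<open>With this lower bound, denying the claim leaves \<open>r > d\<close> together
    with \<open>4 * r \<le> card A\<close>.\<close>
  have "CARD('n) \<le> r" using CARD_le_column_count[OF fin(1) zero, of z] axes' r by simp
  then have "r > CARD('n)" "4 * r \<le> card A" using neg assms(1) by auto
  moreover have "\<exists>t. axis j 1 + axis z t \<in> ?A" if "j \<noteq> z" for j
    using axes'[OF that] by (intro exI[of _ 0]) (simp add: axis_eq_0_iff[THEN iffD2])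
  ultimately obtain A' B' a where red: "reduces_to z ?A ?B A' B'" and norm: "normalised z a A' B'" and az: "a \<noteq> z"
    using exists_normalised[OF fin zero] r by metis
  have red': "finite A'" "finite B'" "card A' = card A" "card B' = card B"
    "card (A' + B') \<le> card (A + B)" "column_count z A' \<le> r"
    using red card sum r by (auto simp: reduces_to_def)
  define \<delta> where "\<delta> = real CARD('n) - 2"
  have "B' \<noteq> {}" using red' assms by force
  then have "real (card A) + (\<delta> + 7 / 3) * real (card B) - (\<delta>\<^sup>2 + 10 / 3 * \<delta> + 16) \<le> real (card (A' + B'))"
    using card_sumset_normalised_ge[OF red'(1,2) _ _ norm az] red' \<open>4 * r \<le> card A\<close> assms(10)
    by (simp add: \<delta>_def)
  moreover have "\<delta>\<^sup>2 + 10 / 3 * \<delta> + 16 \<le> real (E_const d)"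
  proof -
    \<comment> \<open>For \<open>d \<ge> 2\<close> the exponent in \<open>E_const d\<close> is at
      least 2, and \<open>(d + 2)^2 = (\<delta> + 4)^2\<close> already dominates the error
      term.\<close>
    have "(2::nat) ^ 2 \<le> 2 ^ d" using assms(2) by (rule power_increasing) simp
    then have "(d + 2) ^ 2 \<le> (d + 2) ^ (2 ^ d - 2)" by (intro power_increasing) auto
    then have "real ((d + 2) ^ 2) \<le> real (E_const d)" unfolding E_const_def by (rule of_nat_mono)
    moreover have "real ((d + 2) ^ 2) = (\<delta> + 4)\<^sup>2" by (simp add: \<delta>_def assms(1))
    moreover have "\<delta> \<ge> 0" using assms(1,2) by (simp add: \<delta>_def)
    ultimately show ?thesis by (simp add: power2_eq_square algebra_simps)
  qed
  moreover have "0 \<le> 2 ^ (d + 1) * sqrt (real (card A))" by simp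
  moreover have "\<delta> + 7 / 3 = real d + 1 / 3" using assms(1) by (simp add: \<delta>_def)
  moreover have "real (card (A' + B')) \<le> real (card (A + B))" using red'(5) by simp
  ultimately show False using assms(11) by (smt (verit))
qed

end
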